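(* Let $\theta\ge0$, $0\le\alpha<n$, $1\le p<\infty$ and $p\le q<\infty$. Let $\mu,\nu$ be weights on $\mathbb{R}^n$ and $\rho$ a critical radius function. The following statements are equivalent: (1) there is $C>0$ such that $\|M_\alpha^{\rho,\theta}f\|_{L^{q,\infty}(\nu)}\le C\|f\|_{L^{p,1}(\mu)}$ for every measurable $f$; (2) there is $C>0$ such that $\|M_\alpha^{\rho,\theta}(\chi_E)\|_{L^{q,\infty}(\nu)}\le C\mu(E)^{1/p}$ for every measurable set $E\subseteq\mathbb{R}^n$; (3) $$\|\mu,\nu\|_{A_{p,q,\alpha}^{\rho,\theta,\mathcal{R}}}:=\sup_Q\nu(Q)^{1/q}\sup_{0<\mu(P)<\infty}\frac{|P\cap Q|}{(|Q|\psi_\theta(Q))^{1-\alpha/n}}\,\mu(P)^{-1/p}<\infty,$$ where $Q$ ranges over all cubes and $P$ over all measurable sets with $0<\mu(P)<\infty$; (4) $(\mu,\nu)\in A_{p,q,\alpha}^{\rho,\theta,\mathcal{R}}$.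
   Context: A critical radius function is $\rho:\mathbb{R}^n\to(0,\infty)$ for which there are $C_0,N_0>0$ with $C_0^{-1}\rho(x)(1+\frac{|x-y|}{\rho(x)})^{-N_0}\le\rho(y)\le C_0\rho(x)(1+\frac{|x-y|}{\rho(x)})^{N_0/(N_0+1)}$ for all $x,y\in\mathbb{R}^n$. For a cube $Q$ with center $x_Q$ and side-length $r_Q$, $\psi_\theta(Q)=(1+r_Q/\rho(x_Q))^\theta$. The maximal function is $$M_\alpha^{\rho,\theta}f(x)=\sup_{Q\ni x}\frac1{(\psi_\theta(Q)|Q|)^{1-\alpha/n}}\int_Q|f(y)|\,dy,$$ the supremum over all cubes $Q$ containing $x$. A weight is a locally integrable function with values in $(0,\infty)$ a.e.; $\nu(E)=\int_E\nu$. Lorentz quasi-norms: $\|f\|_{L^{p,1}(\mu)}=p\int_0^\infty\mu(\{|f|>y\})^{1/p}\,dy$, $\|f\|_{L^{q,\infty}(\nu)}=\sup_{y>0}y\,\nu(\{|f|>y\})^{1/q}$, and $L^{\infty,\infty}(\mu)=L^\infty(\mu)$. With $1/p+1/p'=1$, $(\mu,\nu)\in A_{p,q,\alpha}^{\rho,\theta,\mathcal{R}}$ means $$[\mu,\nu]_{A_{p,q,\alpha}^{\rho,\theta,\mathcal{R}}}:=\sup_Q\nu(Q)^{1/q}\,\frac{\|\chi_Q\mu^{-1}\|_{L^{p',\infty}(\mu)}}{(|Q|\psi_\theta(Q))^{1-\alpha/n}}<\infty,$$ the supremum over all cubes $Q\subseteq\mathbb{R}^n$. *)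

theory Defs
  imports "HOL-Analysis.Analysis" "HOL-Probability.Essential_Supremum"
begin

definition critical_radius :: "(real^'n \<Rightarrow> real) \<Rightarrow> bool" where
  "critical_radius \<rho> \<longleftrightarrow>
     (\<forall>x. \<rho> x > 0) \<and>
     (\<exists>C0>0. \<exists>N0>0. \<forall>x y.
        inverse C0 * \<rho> x * (1 + norm (x - y) / \<rho> x) powr (- N0) \<le> \<rho> y \<and>
        \<rho> y \<le> C0 * \<rho> x * (1 + norm (x - y) / \<rho> x) powr (N0 / (N0 + 1)))"

text \<open>Cubes have positive side length and sides parallel to the axes. They are taken closed;
  since boundaries of cubes are null sets, nothing below depends on this.
  A supremum over all cubes is a supremum over all centres and all positive side lengths.\<close>

definition cube :: "real^'n \<Rightarrow> real \<Rightarrow> (real^'n) set" where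
  "cube c r = {y. \<forall>i. \<bar>y $ i - c $ i\<bar> \<le> r / 2}"

definition psi :: "(real^'n \<Rightarrow> real) \<Rightarrow> real \<Rightarrow> real^'n \<Rightarrow> real \<Rightarrow> real" where
  "psi \<rho> \<theta> c r = (1 + r / \<rho> c) powr \<theta>"

definition cube_factor :: "(real^'n \<Rightarrow> real) \<Rightarrow> real \<Rightarrow> real \<Rightarrow> real^'n \<Rightarrow> real \<Rightarrow> real" where
  "cube_factor \<rho> \<theta> \<alpha> c r =
     (measure lebesgue (cube c r) * psi \<rho> \<theta> c r) powr (1 - \<alpha> / real CARD('n))"

definition maximal_fun ::
  "(real^'n \<Rightarrow> real) \<Rightarrow> real \<Rightarrow> real \<Rightarrow> (real^'n \<Rightarrow> real) \<Rightarrow> real^'n \<Rightarrow> ennreal" where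
  "maximal_fun \<rho> \<theta> \<alpha> f x =
     (SUP (c, r) \<in> {(c, r). 0 < r \<and> x \<in> cube c r}.
        (\<integral>\<^sup>+y\<in>cube c r. ennreal \<bar>f y\<bar> \<partial>lebesgue) / ennreal (cube_factor \<rho> \<theta> \<alpha> c r))"

text \<open>Values on a null set are immaterial, so weights are real-valued functions that are positive
  almost everywhere.\<close>

definition weight :: "(real^'n \<Rightarrow> real) \<Rightarrow> bool" where
  "weight w \<longleftrightarrow> w \<in> borel_measurable lebesgue \<and>
     (\<forall>K. compact K \<longrightarrow> set_integrable lebesgue K w) \<and>
     (AE x in lebesgue. 0 < w x)"

definition weight_measure :: "(real^'n \<Rightarrow> real) \<Rightarrow> (real^'n) measure" where
  "weight_measure w = density lebesgue (\<lambda>x. ennreal (w x))"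

text \<open>The power \<open>x\<^sup>a\<close> on \<open>[0,\<infinity>]\<close>, used for positive exponents only
  (so \<open>0\<^sup>a = 0\<close> and \<open>\<infinity>\<^sup>a = \<infinity>\<close>).\<close>

definition ennreal_pow :: "ennreal \<Rightarrow> real \<Rightarrow> ennreal" where
  "ennreal_pow x a = (if x = \<infinity> then \<infinity> else ennreal (enn2real x powr a))"

text \<open>The Lorentz quasi-norms take the absolute value \<open>g = \<bar>f\<bar>\<close>, as a function into \<open>[0,\<infinity>]\<close>.\<close>

definition lorentz_p1 :: "real \<Rightarrow> 'a measure \<Rightarrow> ('a \<Rightarrow> ennreal) \<Rightarrow> ennreal" where
  "lorentz_p1 p M g =
     ennreal p * (\<integral>\<^sup>+y\<in>{0<..}. ennreal_pow (emeasure M {x \<in> space M. ennreal y < g x}) (1 / p) \<partial>lborel)"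

definition lorentz_weak :: "ereal \<Rightarrow> 'a measure \<Rightarrow> ('a \<Rightarrow> ennreal) \<Rightarrow> ennreal" where
  "lorentz_weak q M g =
     (if q = \<infinity> then esssup M g
      else SUP y\<in>{0<..}. ennreal y *
             ennreal_pow (emeasure M {x \<in> space M. ennreal y < g x}) (1 / real_of_ereal q))"

definition conj_exponent :: "real \<Rightarrow> ereal" where
  "conj_exponent p = (if p = 1 then \<infinity> else ereal (p / (p - 1)))"

definition A_R_const ::
  "(real^'n \<Rightarrow> real) \<Rightarrow> real \<Rightarrow> real \<Rightarrow> real \<Rightarrow> real \<Rightarrow> (real^'n \<Rightarrow> real) \<Rightarrow> (real^'n \<Rightarrow> real) \<Rightarrow> ennreal" where
  "A_R_const \<rho> \<theta> \<alpha> p q \<mu> \<nu> =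
     (SUP (c, r) \<in> UNIV \<times> {0<..}.
        ennreal_pow (emeasure (weight_measure \<nu>) (cube c r)) (1 / q) *
        (lorentz_weak (conj_exponent p) (weight_measure \<mu>)
            (\<lambda>x. ennreal (indicator (cube c r) x * inverse (\<mu> x)))
          / ennreal (cube_factor \<rho> \<theta> \<alpha> c r)))"

definition A_R_class ::
  "(real^'n \<Rightarrow> real) \<Rightarrow> real \<Rightarrow> real \<Rightarrow> real \<Rightarrow> real \<Rightarrow> ((real^'n \<Rightarrow> real) \<times> (real^'n \<Rightarrow> real)) set" where
  "A_R_class \<rho> \<theta> \<alpha> p q = {(\<mu>, \<nu>). A_R_const \<rho> \<theta> \<alpha> p q \<mu> \<nu> < \<infinity>}"

definition A_R_norm ::
  "(real^'n \<Rightarrow> real) \<Rightarrow> real \<Rightarrow> real \<Rightarrow> real \<Rightarrow> real \<Rightarrow> (real^'n \<Rightarrow> real) \<Rightarrow> (real^'n \<Rightarrow> real) \<Rightarrow> ennreal" where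
  "A_R_norm \<rho> \<theta> \<alpha> p q \<mu> \<nu> =
     (SUP (c, r) \<in> UNIV \<times> {0<..}.
        ennreal_pow (emeasure (weight_measure \<nu>) (cube c r)) (1 / q) *
        (SUP P \<in> {P \<in> sets lebesgue. 0 < emeasure (weight_measure \<mu>) P \<and>
                                     emeasure (weight_measure \<mu>) P < \<infinity>}.
           emeasure lebesgue (P \<inter> cube c r) / ennreal (cube_factor \<rho> \<theta> \<alpha> c r)
             * inverse (ennreal_pow (emeasure (weight_measure \<mu>) P) (1 / p))))"

end

theory Submission
  imports Defs
begin

text \<open>The weak type bound follows from condition (3) by a covering argument. The level sets of the
  maximal function are open, so they are exhausted by compact sets, each covered by finitely many
  cubes \<open>Q\<close> with large average; among these one selects disjoint ones whose dilates \<open>3Q\<close> still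
  cover. Condition (3) on \<open>3Q\<close>, applied to the level sets of \<open>f\<close> inside \<open>Q\<close> and integrated by the
  layer cake formula, bounds \<open>\<nu>(3Q)\<close> by the \<open>L\<^sup>p\<^sup>,\<^sup>1\<close> norm of \<open>f\<close> restricted to \<open>Q\<close>, because \<open>3Q\<close> and
  \<open>Q\<close> have comparable factors. For disjoint \<open>Q\<close> the \<open>q\<close>-th powers of these norms add up to at
  most that of the whole, since \<open>p \<le> q\<close>. Conversely, testing on \<open>\<chi>\<^sub>P\<close> gives (3). Conditions (3) and
  (4) agree cube by cube, up to the factor \<open>p\<close>: \<open>\<bar>P \<inter> Q\<bar>\<close> is the integral of \<open>\<chi>\<^sub>Q \<mu>\<^sup>-\<^sup>1\<close> over \<open>P\<close>
  with respect to \<open>\<mu>\<close>, which reduces them to Hoelder's inequality for Lorentz spaces and to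
  Markov's inequality on \<open>P = {\<chi>\<^sub>Q \<mu>\<^sup>-\<^sup>1 > y}\<close>.\<close>

section \<open>Powers in the extended nonnegative reals\<close>

lemma ennreal_pow_top [simp]: "ennreal_pow top a = top"
  by (simp add: ennreal_pow_def)

lemma ennreal_pow_ennreal: "0 \<le> x \<Longrightarrow> ennreal_pow (ennreal x) a = ennreal (x powr a)"
  by (simp add: ennreal_pow_def)

lemma ennreal_pow_0 [simp]: "ennreal_pow 0 a = 0"
  by (simp add: ennreal_pow_def)

lemma ennreal_pow_1 [simp]: "ennreal_pow x 1 = x"
  by (cases x) (auto simp: ennreal_pow_def)

lemma ennreal_pow_mono: "x \<le> y \<Longrightarrow> 0 \<le> a \<Longrightarrow> ennreal_pow x a \<le> ennreal_pow y a"
  by (cases x; cases y) (auto simp: ennreal_pow_ennreal powr_mono2 ennreal_leI top_unique)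

lemma borel_measurable_ennreal_pow [measurable]:
  assumes [measurable]: "f \<in> borel_measurable M"
  shows "(\<lambda>x. ennreal_pow (f x) a) \<in> borel_measurable M"
  unfolding ennreal_pow_def by measurable

lemma ennreal_pow_powr_inverse: "0 < q \<Longrightarrow> ennreal_pow (ennreal_pow x (1 / q)) q = x"
  by (cases x) (auto simp: ennreal_pow_ennreal powr_powr)

lemma ennreal_pow_inverse_powr: "0 < q \<Longrightarrow> ennreal_pow (ennreal_pow x q) (1 / q) = x"
  by (cases x) (auto simp: ennreal_pow_ennreal powr_powr)

lemma ennreal_pow_cmult: "0 < a \<Longrightarrow> ennreal_pow (ennreal a * x) q = ennreal (a powr q) * ennreal_pow x q"
  by (cases x) (auto simp: ennreal_pow_ennreal powr_mult ennreal_mult_top simp flip: ennreal_mult)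

text \<open>Both bounds matter: for \<open>m = 0\<close> and for \<open>m = top\<close> the product
  is 0 in \<open>ennreal\<close>.\<close>

lemma ennreal_mult_inverse_pow:
  assumes "0 < m" "m < \<infinity>"
  shows "ennreal_pow m a * inverse (ennreal_pow m a) = 1"
proof -
  obtain x where "m = ennreal x" "0 < x"
    using assms by (cases m) auto
  then show ?thesis
    by (simp add: ennreal_pow_ennreal inverse_ennreal flip: ennreal_mult)
qed

section \<open>Layer cake formula and distribution functions\<close>

text \<open>Closed balls of integer radius are compact and exhaust the space. Any measure on the
  Lebesgue sets is allowed, so that \<open>lebesgue\<close> and the weight measures are treated
  alike.\<close>

lemma sigma_finite_measure_compact:
  fixes M :: "'a::euclidean_space measure"
  assumes "sets M = sets lebesgue" and "\<And>K. compact K \<Longrightarrow> emeasure M K < \<infinity>"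
  shows "sigma_finite_measure M"
proof
  have "space M = UNIV"
    using assms(1) sets_eq_imp_space_eq by fastforce
  moreover have "\<Union> (range (\<lambda>n. cball (0::'a) (real n))) = UNIV"
    by (auto simp: real_arch_simple)
  moreover have "range (\<lambda>n. cball (0::'a) (real n)) \<subseteq> sets M"
    unfolding assms(1) by auto
  moreover have "emeasure M (cball (0::'a) (real n)) \<noteq> \<infinity>" for n
    using assms(2)[of "cball 0 (real n)"] by simp
  ultimately show "\<exists>A. countable A \<and> A \<subseteq> sets M \<and> \<Union> A = space M \<and> (\<forall>a\<in>A. emeasure M a \<noteq> \<infinity>)"
    by (intro exI[of _ "range (\<lambda>n. cball (0::'a) (real n))"]) blast
qed

lemma sigma_finite_lebesgue: "sigma_finite_measure (lebesgue :: 'a::euclidean_space measure)"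
  proof (rule sigma_finite_measure_compact)
  fix K :: "'a set" assume K: "compact K"
  then have "emeasure lebesgue K = emeasure lborel K"
    by (simp add: emeasure_completion borel_compact)
  with emeasure_compact_finite[OF K] show "emeasure lebesgue K < \<infinity>"
    by simp
qed simp

context sigma_finite_measure
begin

text \<open>The values are the measures of the sections of the region \<open>y < g x\<close> in the
  product space, and sigma-finiteness makes section measures measurable.\<close>

lemma borel_measurable_distribution_function:
  fixes g :: "'a \<Rightarrow> real"
  assumes [measurable]: "g \<in> borel_measurable M"
  shows "(\<lambda>y::real. emeasure M {x \<in> space M. y < g x}) \<in> borel_measurable borel"
proof -
  have "(\<lambda>y::real. emeasure M (Pair y -` {z \<in> space (borel \<Otimes>\<^sub>M M). fst z < g (snd z)}))
          \<in> borel_measurable borel"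
    by (rule measurable_emeasure_Pair) measurable
  then show ?thesis
    by (simp add: space_pair_measure vimage_def)
qed

text \<open>\<open>ennreal (g x)\<close> is the length of \<open>{0<..<g x}\<close>, also for
  negative \<open>g x\<close>, where both are 0; exchanging the order of integration gives the
  formula.\<close>

lemma nn_integral_layer_cake:
  fixes g :: "'a \<Rightarrow> real"
  assumes [measurable]: "g \<in> borel_measurable M"
  shows "(\<integral>\<^sup>+x. ennreal (g x) \<partial>M) = (\<integral>\<^sup>+y\<in>{0<..}. emeasure M {x \<in> space M. y < g x} \<partial>lborel)"
proof -
  interpret P: pair_sigma_finite lborel M
    by unfold_locales
  have "ennreal (g x) = (\<integral>\<^sup>+y. indicator {0<..<g x} y \<partial>lborel)" for x
    by (cases "0 \<le> g x") (auto simp: ennreal_neg)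
  then have "(\<integral>\<^sup>+x. ennreal (g x) \<partial>M)
      = (\<integral>\<^sup>+x. (\<integral>\<^sup>+y. indicator {z. 0 < fst z \<and> fst z < g (snd z)} (y, x) \<partial>lborel) \<partial>M)"
    by (auto intro!: nn_integral_cong simp: indicator_def)
  also have "\<dots> = (\<integral>\<^sup>+y. (\<integral>\<^sup>+x. indicator {z. 0 < fst z \<and> fst z < g (snd z)} (y, x) \<partial>M) \<partial>lborel)"
    by (intro P.Fubini') (auto simp: split_beta' indicator_def)
  also have "\<dots> = (\<integral>\<^sup>+y\<in>{0<..}. emeasure M {x \<in> space M. y < g x} \<partial>lborel)"
  proof (intro nn_integral_cong)
    fix y :: real
    have "(\<integral>\<^sup>+x. indicator {z. 0 < fst z \<and> fst z < g (snd z)} (y, x) \<partial>M)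
        = (\<integral>\<^sup>+x. indicator {x \<in> space M. y < g x} x * indicator {0<..} y \<partial>M)"
      by (intro nn_integral_cong) (auto simp: indicator_def)
    then show "(\<integral>\<^sup>+x. indicator {z. 0 < fst z \<and> fst z < g (snd z)} (y, x) \<partial>M)
        = emeasure M {x \<in> space M. y < g x} * indicator {0<..} y"
      by (simp add: nn_integral_multc)
  qed
  finally show ?thesis .
qed

end

lemma nn_integral_powr_tail:
  fixes A a s :: real
  assumes "0 < a" and "1 < s" and "0 \<le> A"
  shows "(\<integral>\<^sup>+y\<in>{a..}. ennreal (A * y powr (- s)) \<partial>lborel) = ennreal (A * a powr (1 - s) / (s - 1))"
proof -
  let ?F = "\<lambda>y. - (A * y powr (1 - s) / (s - 1))"
  have "(\<integral>\<^sup>+y. ennreal (A * y powr (- s)) * indicator {a..} y \<partial>lborel) = ennreal (0 - ?F a)"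
  proof (rule nn_integral_FTC_atLeast)
    show "(?F \<longlongrightarrow> 0) at_top"
    proof -
      have "((\<lambda>y. y powr (1 - s)) \<longlongrightarrow> 0) at_top"
        using assms by (intro tendsto_neg_powr filterlim_ident) auto
      from tendsto_minus[OF tendsto_divide[OF tendsto_mult_left[OF this, of A] tendsto_const[of "s - 1"]]]
      show ?thesis using assms by simp
    qed
    fix y assume "a \<le> y"
    with assms have "0 < y" by linarith
    have "((\<lambda>y. - A / (s - 1) * y powr (1 - s)) has_real_derivative
        - A / (s - 1) * ((1 - s) * y powr (1 - s - 1))) (at y)"
      using \<open>0 < y\<close> by (intro DERIV_cmult has_real_derivative_powr)
    moreover have "- A / (s - 1) * ((1 - s) * y powr (1 - s - 1)) = A * y powr (- s)"
      using assms by (simp add: divide_simps) (simp add: algebra_simps)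
    ultimately show "(?F has_real_derivative A * y powr (- s)) (at y)"
      by simp
  qed (use assms in auto)
  then show ?thesis by simp
qed

section \<open>Hoelder inequality between Lorentz spaces\<close>

text \<open>The layer cake integral is split at a height \<open>y0\<close>. Below it the
  distribution function of \<open>g\<close> on \<open>P\<close> is at most \<open>m\<close>; above
  it the weak bound decays like \<open>y powr (- s)\<close>, with \<open>s\<close> the conjugate
  exponent. The parts contribute \<open>A * m powr (1 / p)\<close> and \<open>p - 1\<close> times as
  much, hence the factor \<open>p\<close>.\<close>

lemma (in sigma_finite_measure) nn_integral_le_of_weak_bound:
  fixes g :: "'a \<Rightarrow> real"
  assumes [measurable]: "g \<in> borel_measurable M" "P \<in> sets M"
    and p: "1 < p" and A: "0 < A" and m: "emeasure M P = ennreal m" "0 < m"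
    and weak: "\<And>y. 0 < y \<Longrightarrow>
      ennreal y * ennreal_pow (emeasure M {x \<in> space M. y < g x}) (1 - 1 / p) \<le> ennreal A"
  shows "(\<integral>\<^sup>+x\<in>P. ennreal (g x) \<partial>M) \<le> ennreal (p * A * m powr (1 / p))"
proof -
  define s where "s = p / (p - 1)"
  \<comment> \<open>the height at which the trivial bound \<open>m\<close> and the weak type bound on the distribution function agree\<close>
  define y0 where "y0 = A * m powr (1 / p - 1)"
  have s: "1 < s" and s1: "s - 1 = 1 / (p - 1)" and sp: "(1 - 1 / p) * s = 1"
    using p by (auto simp: s_def field_simps)
  have y0: "0 < y0"
    using A m by (simp add: y0_def)
  have tail: "emeasure M {x \<in> space M. y < g x} \<le> ennreal (A powr s * y powr (- s))" if y: "0 < y" for y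
  proof -
    have fin: "emeasure M {x \<in> space M. y < g x} \<noteq> top"
      using weak[OF y] y by (auto simp: ennreal_mult_top top_unique)
    define k where "k = measure M {x \<in> space M. y < g x}"
    have k: "emeasure M {x \<in> space M. y < g x} = ennreal k"
      using fin by (simp add: k_def emeasure_eq_ennreal_measure)
    have "0 \<le> k" by (simp add: k_def)
    then have "y * k powr (1 - 1 / p) \<le> A"
      using weak[OF y] y A by (simp add: k ennreal_pow_ennreal flip: ennreal_mult)
    then have "k powr (1 - 1 / p) \<le> A / y"
      using y by (simp add: field_simps)
    then have "(k powr (1 - 1 / p)) powr s \<le> (A / y) powr s"
      using s by (intro powr_mono2) auto
    then have "k \<le> (A / y) powr s"
      using \<open>0 \<le> k\<close> by (simp add: powr_powr sp)
    moreover have "(A / y) powr s = A powr s * y powr (- s)"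
      using A y by (simp add: powr_divide powr_minus field_simps)
    ultimately show ?thesis
      by (simp add: k ennreal_leI)
  qed
  have "(\<integral>\<^sup>+x\<in>P. ennreal (g x) \<partial>M) = (\<integral>\<^sup>+x. ennreal (g x * indicator P x) \<partial>M)"
    by (intro nn_integral_cong) (auto simp: indicator_def)
  also have "\<dots> = (\<integral>\<^sup>+y\<in>{0<..}. emeasure M {x \<in> space M. y < g x * indicator P x} \<partial>lborel)"
    by (rule nn_integral_layer_cake) measurable
  also have "\<dots> \<le> (\<integral>\<^sup>+y. ennreal m * indicator {0..y0} y
                     + ennreal (A powr s * y powr (- s)) * indicator {y0..} y \<partial>lborel)"
  proof (intro nn_integral_mono)
    fix y :: real
    show "emeasure M {x \<in> space M. y < g x * indicator P x} * indicator {0<..} y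
          \<le> ennreal m * indicator {0..y0} y + ennreal (A powr s * y powr (- s)) * indicator {y0..} y"
    proof (cases "0 < y")
      case True
      have "emeasure M {x \<in> space M. y < g x * indicator P x} \<le> emeasure M P"
        using True by (intro emeasure_mono) (auto simp: indicator_def split: if_splits)
      moreover have "emeasure M {x \<in> space M. y < g x * indicator P x} \<le> emeasure M {x \<in> space M. y < g x}"
        using True by (intro emeasure_mono) (auto simp: indicator_def split: if_splits)
      moreover note tail[OF True]
      ultimately show ?thesis
        using True unfolding m by (cases "y \<le> y0"; cases "y = y0") (auto intro: add_increasing2)
    qed simp
  qed
  also have "\<dots> = ennreal m * ennreal y0 + ennreal (A powr s * y0 powr (1 - s) / (s - 1))"
    using y0 nn_integral_powr_tail[OF y0 s, of "A powr s"]
    by (subst nn_integral_add) (auto simp: nn_integral_cmult_indicator)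
  also have "\<dots> = ennreal (m * y0 + A powr s * y0 powr (1 - s) / (s - 1))"
    using m y0 s by (simp add: ennreal_mult)
  also have "m * y0 + A powr s * y0 powr (1 - s) / (s - 1) = p * A * m powr (1 / p)"
  proof -
    have "(1 / p - 1) * (1 - s) = 1 / p"
      using p by (simp add: s_def field_simps)
    then have "y0 powr (1 - s) = A powr (1 - s) * m powr (1 / p)"
      using A m by (simp add: y0_def powr_mult powr_powr)
    then have "A powr s * y0 powr (1 - s) = A * m powr (1 / p)"
      using A by (simp add: powr_diff)
    moreover have "m * y0 = A * m powr (1 / p)"
      using m by (simp add: y0_def powr_diff)
    ultimately show ?thesis
      using p by (simp add: s1 algebra_simps)
  qed
  finally show ?thesis .
qed

lemma real_conj_exponent: "1 < p \<Longrightarrow> 1 / real_of_ereal (conj_exponent p) = 1 - 1 / p"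
  by (simp add: conj_exponent_def field_simps)

text \<open>For \<open>p = 1\<close> the weak norm is an essential supremum and can be pulled out of
  the integral; for \<open>p > 1\<close> the split layer cake estimate applies.\<close>

lemma (in sigma_finite_measure) Lorentz_Hoelder:
  fixes g :: "'a \<Rightarrow> real"
  assumes [measurable]: "g \<in> borel_measurable M" "P \<in> sets M"
    and p: "1 \<le> p"
    and P: "0 < emeasure M P" "emeasure M P < \<infinity>"
  shows "(\<integral>\<^sup>+x\<in>P. ennreal (g x) \<partial>M)
    \<le> ennreal p * lorentz_weak (conj_exponent p) M (\<lambda>x. ennreal (g x)) * ennreal_pow (emeasure M P) (1 / p)"
proof (cases "p = 1")
  case True
  have "AE x in M. ennreal (g x) \<le> esssup M (\<lambda>x. ennreal (g x))"
    by (rule esssup_AE)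
  then have "(\<integral>\<^sup>+x\<in>P. ennreal (g x) \<partial>M) \<le> (\<integral>\<^sup>+x\<in>P. esssup M (\<lambda>x. ennreal (g x)) \<partial>M)"
    by (intro nn_integral_mono_AE) (auto simp: indicator_def elim!: eventually_mono)
  also have "\<dots> = esssup M (\<lambda>x. ennreal (g x)) * emeasure M P"
    by (simp add: nn_integral_cmult_indicator)
  finally show ?thesis
    by (simp add: True lorentz_weak_def conj_exponent_def)
next
  case False
  with p have p: "1 < p" by simp
  obtain m where m: "emeasure M P = ennreal m" "0 < m"
    using P by (cases "emeasure M P") auto
  let ?L = "lorentz_weak (conj_exponent p) M (\<lambda>x. ennreal (g x))"
  let ?c = "ennreal (p * m powr (1 / p))"
  have c: "0 < p * m powr (1 / p)"
    using p m by simp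
  have L: "?L = (SUP y\<in>{0<..}. ennreal y * ennreal_pow (emeasure M {x \<in> space M. y < g x}) (1 - 1 / p))"
    using p
    by (auto simp: lorentz_weak_def real_conj_exponent ennreal_less_iff intro!: SUP_cong)
      (auto simp: conj_exponent_def)
  have "(\<integral>\<^sup>+x\<in>P. ennreal (g x) \<partial>M) / ?c \<le> ?L"
  proof (rule dense_ge)
    \<comment> \<open>The estimate for weak bounds asks for a positive real constant. Any finite
      \<open>z\<close> above the weak norm provides one, even if the norm itself is 0.\<close>
    fix z assume z: "?L < z"
    show "(\<integral>\<^sup>+x\<in>P. ennreal (g x) \<partial>M) / ?c \<le> z"
    proof (cases z)
      case (real A)
      with z have A: "0 < A"
        by (cases "A = 0") auto
      have "(\<integral>\<^sup>+x\<in>P. ennreal (g x) \<partial>M) \<le> ennreal (p * A * m powr (1 / p))"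
      proof (rule nn_integral_le_of_weak_bound[OF _ _ p A m])
        fix y :: real assume "0 < y"
        then have "ennreal y * ennreal_pow (emeasure M {x \<in> space M. y < g x}) (1 - 1 / p) \<le> ?L"
          unfolding L by (intro SUP_upper) auto
        with z real show "ennreal y * ennreal_pow (emeasure M {x \<in> space M. y < g x}) (1 - 1 / p) \<le> ennreal A"
          by simp
      qed measurable
      also have "\<dots> = ?c * z"
        using p A real by (simp add: ac_simps flip: ennreal_mult)
      finally show ?thesis
        using c by (intro divide_le_posI_ennreal) auto
    qed simp
  qed
  moreover have "?c / ?c = 1"
    using c by (intro ennreal_divide_self) auto
  ultimately have "(\<integral>\<^sup>+x\<in>P. ennreal (g x) \<partial>M) \<le> ?L * ?c"
    using mult_right_mono[of "(\<integral>\<^sup>+x\<in>P. ennreal (g x) \<partial>M) / ?c" ?L ?c]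
    by (simp add: ennreal_divide_times)
  then show ?thesis
    using p m by (simp add: ennreal_pow_ennreal ennreal_mult ac_simps)
qed

text \<open>The test sets are the level sets \<open>{g > y}\<close>. If \<open>m\<close> is the
  measure of such a set, Markov's inequality bounds \<open>y * m\<close> by the integral of
  \<open>g\<close> over it, and division by \<open>m powr (1 / p)\<close> leaves
  \<open>y * m powr (1 - 1 / p)\<close>. The hypothesis \<open>fin\<close> gives the level sets
  finite measure, so that \<open>bound\<close> covers them.\<close>

lemma lorentz_weak_le_of_restricted_bound:
  fixes g :: "'a \<Rightarrow> real"
  assumes [measurable]: "g \<in> borel_measurable M"
    and p: "1 \<le> p"
    and fin: "(\<integral>\<^sup>+x. ennreal (g x) \<partial>M) < \<infinity>"
    and bound: "\<And>P. \<lbrakk>P \<in> sets M; 0 < emeasure M P; emeasure M P < \<infinity>\<rbrakk> \<Longrightarrow>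
      (\<integral>\<^sup>+x\<in>P. ennreal (g x) \<partial>M) * inverse (ennreal_pow (emeasure M P) (1 / p)) \<le> S"
  shows "lorentz_weak (conj_exponent p) M (\<lambda>x. ennreal (g x)) \<le> S"
proof -
  \<comment> \<open>At \<open>p = 1\<close> the exponent \<open>1 - 1 / p\<close> is 0 and the bound
    degenerates to \<open>y \<le> S\<close> for every level set of positive measure;
    \<open>main0\<close> is the form in which it limits the essential supremum.\<close>
  have main: "ennreal y * ennreal_pow (emeasure M {x \<in> space M. y < g x}) (1 - 1 / p) \<le> S"
      and main0: "p = 1 \<Longrightarrow> 0 < emeasure M {x \<in> space M. y < g x} \<Longrightarrow> ennreal y \<le> S"
    if y: "0 < y" for y
  proof -
    let ?P = "{x \<in> space M. y < g x}"
    have le: "ennreal y * emeasure M ?P \<le> (\<integral>\<^sup>+x\<in>?P. ennreal (g x) \<partial>M)"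
      using y by (auto simp: indicator_def ennreal_leI intro!: nn_integral_mono
          simp flip: nn_integral_cmult_indicator)
    also have "\<dots> \<le> (\<integral>\<^sup>+x. ennreal (g x) \<partial>M)"
      by (intro nn_integral_mono) (auto simp: indicator_def)
    finally have "emeasure M ?P \<noteq> top"
      using fin y by (auto simp: ennreal_mult_top top_unique)
    then obtain m where m: "emeasure M ?P = ennreal m" "0 \<le> m"
      by (cases "emeasure M ?P") auto
    have *: "ennreal (y * m powr (1 - 1 / p)) \<le> S" if "0 < m"
    proof -
      have "ennreal (y * m powr (1 - 1 / p)) = ennreal (y * m) * inverse (ennreal (m powr (1 / p)))"
        using that y by (simp add: inverse_ennreal powr_diff divide_inverse flip: ennreal_mult)
      also have "\<dots> \<le> (\<integral>\<^sup>+x\<in>?P. ennreal (g x) \<partial>M) * inverse (ennreal_pow (emeasure M ?P) (1 / p))"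
        using le m y by (intro mult_mono) (auto simp: ennreal_pow_ennreal ennreal_mult)
      also have "\<dots> \<le> S"
        by (rule bound) (use m that in auto)
      finally show ?thesis .
    qed
    show "ennreal y * ennreal_pow (emeasure M ?P) (1 - 1 / p) \<le> S"
      using * m y by (cases "m = 0") (auto simp: ennreal_pow_ennreal ennreal_mult)
    show "ennreal y \<le> S" if "p = 1" "0 < emeasure M ?P"
      using * that m by auto
  qed
  show ?thesis
  proof (cases "p = 1")
    case True
    have "esssup M (\<lambda>x. ennreal (g x)) \<le> S"
    proof (rule ccontr)
      assume "\<not> ?thesis"
      then obtain z where z: "S < z" "z < esssup M (\<lambda>x. ennreal (g x))"
        by (meson dense not_le)
      then obtain y where y: "z = ennreal y" "0 \<le> y"
        by (cases z) auto
      have "0 < emeasure M {x \<in> space M. z < ennreal (g x)}"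
        by (rule esssup_pos_measure) (use z in auto)
      also have "{x \<in> space M. z < ennreal (g x)} = {x \<in> space M. y < g x}"
        using y by (auto simp: ennreal_less_iff)
      finally have "z \<le> S"
        using main0[of y] True z y by (cases "y = 0") auto
      with z show False by simp
    qed
    then show ?thesis
      by (simp add: True lorentz_weak_def conj_exponent_def)
  next
    case False
    with p have "1 < p" by simp
    moreover from this have "conj_exponent p \<noteq> \<infinity>"
      by (simp add: conj_exponent_def)
    ultimately show ?thesis
      using main by (auto simp: lorentz_weak_def real_conj_exponent ennreal_less_iff intro!: SUP_least)
  qed
qed

section \<open>An upper estimate for restrictions to disjoint sets\<close>

text \<open>By convexity the graph of \<open>t powr q\<close> lies above its tangent at
  \<open>s\<close>; the negative constant term has been moved to the right. The inequality is
  Young's with weights \<open>1 / q\<close> and \<open>1 - 1 / q\<close>. At \<open>s = 0\<close>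
  the left side vanishes even for \<open>q = 1\<close>, because \<open>0 powr 0 = 0\<close>.\<close>

lemma powr_ge_tangent:
  fixes s t q :: real
  assumes "1 \<le> q" and "0 \<le> s" and "0 \<le> t"
  shows "q * s powr (q - 1) * t \<le> t powr q + (q - 1) * s powr q"
proof (cases "s = 0 \<or> t = 0")
  case False
  with assms have "(t powr q) powr (1 / q) * (s powr q) powr (1 - 1 / q)
      \<le> 1 / q * t powr q + (1 - 1 / q) * s powr q"
    using Youngs_inequality_0[of "1 / q" "1 - 1 / q" "t powr q" "s powr q"] by simp
  moreover have "q * (1 - 1 / q) = q - 1"
    using assms by (simp add: field_simps)
  ultimately have "t * s powr (q - 1) \<le> 1 / q * t powr q + (1 - 1 / q) * s powr q"
    using assms by (simp add: powr_powr)
  then have "q * (t * s powr (q - 1)) \<le> q * (1 / q * t powr q + (1 - 1 / q) * s powr q)"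
    using assms by (intro mult_left_mono) auto
  also have "\<dots> = t powr q + (q - 1) * s powr q"
    using assms by (simp add: field_simps)
  finally show ?thesis
    by (simp add: ac_simps)
qed (use assms in auto)

text \<open>Jensen's inequality for the probability measure with density \<open>h / \<integral>h\<close>, applied to \<open>g\<^sub>j / h\<close>: it is
  obtained by integrating the tangent inequality at \<open>s\<^sub>j = (\<integral>g\<^sub>j) / (\<integral>h)\<close>.\<close>

lemma sum_integral_powr_le:
  fixes g :: "'i \<Rightarrow> 'a \<Rightarrow> real" and h :: "'a \<Rightarrow> real"
  assumes "finite J" and q: "1 \<le> q"
    and h: "integrable M h" "\<And>x. 0 \<le> h x"
    and g: "\<And>j. j \<in> J \<Longrightarrow> g j \<in> borel_measurable M" "\<And>j x. 0 \<le> g j x"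
    and le: "AE x in M. (\<Sum>j\<in>J. g j x powr q) \<le> h x powr q"
  shows "(\<Sum>j\<in>J. (\<integral>x. g j x \<partial>M) powr q) \<le> (\<integral>x. h x \<partial>M) powr q"
proof -
  define I where "I = (\<integral>x. h x \<partial>M)"
  note [measurable] = g(1) borel_measurable_integrable[OF h(1)]
  have g_le: "AE x in M. g j x \<le> h x" if j: "j \<in> J" for j
    using le
  proof eventually_elim
    case (elim x)
    have "g j x powr q \<le> (\<Sum>j\<in>J. g j x powr q)"
      using j \<open>finite J\<close> by (intro member_le_sum) auto
    with elim have "g j x powr q \<le> h x powr q" by simp
    then show ?case
      using q g(2) h(2) powr_less_mono2[of q "h x" "g j x"] by (auto simp: not_less[symmetric])
  qed
  have g_int: "integrable M (g j)" if "j \<in> J" for j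
    using g_le[OF that] g(2) h(2) that by (intro Bochner_Integration.integrable_bound[OF h(1)]) auto
  have I0: "0 \<le> I"
    using h(2) by (simp add: I_def)
  have a0: "0 \<le> (\<integral>x. g j x \<partial>M)" for j
    using g(2) by simp
  have aI: "(\<integral>x. g j x \<partial>M) \<le> I" if "j \<in> J" for j
    unfolding I_def using that by (intro integral_mono_AE g_int h(1) g_le)
  show ?thesis
  proof (cases "I = 0")
    case True
    have "(\<integral>x. g j x \<partial>M) = 0" if "j \<in> J" for j
      using a0[of j] aI[OF that] True by simp
    then show ?thesis
      by simp
  next
    case False
    with I0 have I: "0 < I" by simp
    define s where "s = (\<lambda>j. (\<integral>x. g j x \<partial>M) / I)"
    \<comment> \<open>This is \<open>h\<close> times the \<open>q\<close>-th power of
      \<open>g j / h\<close>, written so that it is 0 where \<open>h\<close> vanishes. By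
      \<open>le\<close> these functions sum to at most \<open>h\<close> almost everywhere.\<close>
    define u where "u = (\<lambda>j x. g j x powr q * h x powr (1 - q))"
    have s0: "0 \<le> s j" for j
      using a0 I by (simp add: s_def)
    have a_eq: "(\<integral>x. g j x \<partial>M) = s j * I" for j
      using I by (simp add: s_def)
    have u_sum: "AE x in M. (\<Sum>j\<in>J. u j x) \<le> h x"
      using le
    proof eventually_elim
      case (elim x)
      have "(\<Sum>j\<in>J. u j x) = (\<Sum>j\<in>J. g j x powr q) * h x powr (1 - q)"
        by (simp add: u_def sum_distrib_right)
      also have "\<dots> \<le> h x powr q * h x powr (1 - q)"
        using elim by (intro mult_right_mono) auto
      also have "\<dots> = h x"
        using h(2)[of x] by (simp add: flip: powr_add)
      finally show ?case .
    qed
    have u_le: "AE x in M. u j x \<le> h x" if j: "j \<in> J" for j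
      using u_sum
    proof eventually_elim
      case (elim x)
      have "u j x \<le> (\<Sum>j\<in>J. u j x)"
        using j \<open>finite J\<close> by (intro member_le_sum) (auto simp: u_def)
      with elim show ?case by simp
    qed
    have [measurable]: "u j \<in> borel_measurable M" if "j \<in> J" for j
      using that unfolding u_def by measurable
    have u_int: "integrable M (u j)" if "j \<in> J" for j
      using u_le[OF that] h(2) that
      by (intro Bochner_Integration.integrable_bound[OF h(1)]) (auto simp: u_def)
    have key: "s j powr q * I \<le> (\<integral>x. u j x \<partial>M)" if j: "j \<in> J" for j
    proof -
      have "AE x in M. q * s j powr (q - 1) * g j x \<le> u j x + (q - 1) * s j powr q * h x"
        using g_le[OF j]
      proof eventually_elim
        case (elim x)
        show ?case
        proof (cases "h x = 0")
          case True
          with elim g(2)[of j x] show ?thesis by (simp add: u_def)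
        next
          case False
          with h(2)[of x] have hx: "0 < h x" by simp
          have "q * s j powr (q - 1) * (g j x / h x) * h x
              \<le> ((g j x / h x) powr q + (q - 1) * s j powr q) * h x"
            using hx g(2) q s0 by (intro mult_right_mono powr_ge_tangent) auto
          moreover have "(g j x / h x) powr q * h x = u j x"
            using hx g(2) by (simp add: u_def powr_divide powr_diff)
          ultimately show ?thesis
            using hx by (simp add: distrib_right)
        qed
      qed
      then have "(\<integral>x. q * s j powr (q - 1) * g j x \<partial>M) \<le> (\<integral>x. u j x + (q - 1) * s j powr q * h x \<partial>M)"
        using g_int[OF j] u_int[OF j] h(1) by (intro integral_mono_AE) auto
      then have "q * s j powr (q - 1) * (s j * I) \<le> (\<integral>x. u j x \<partial>M) + (q - 1) * s j powr q * I"
        using g_int[OF j] u_int[OF j] h(1) by (simp add: a_eq flip: I_def)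
      moreover have "s j powr (q - 1) * s j = s j powr q"
        using s0[of j] powr_mult_base[of "s j" "q - 1"] by (simp add: mult.commute)
      ultimately show ?thesis
        by (simp add: algebra_simps)
    qed
    \<comment> \<open>Dividing by \<open>I\<close> shows that the numbers \<open>s j powr q\<close>
      sum to at most 1, which is the claim up to scaling by \<open>I powr q\<close>.\<close>
    have "(\<Sum>j\<in>J. s j powr q) * I \<le> (\<Sum>j\<in>J. (\<integral>x. u j x \<partial>M))"
      unfolding sum_distrib_right by (intro sum_mono key)
    also have "\<dots> = (\<integral>x. (\<Sum>j\<in>J. u j x) \<partial>M)"
      by (intro Bochner_Integration.integral_sum[symmetric] u_int)
    also have "\<dots> \<le> I"
      unfolding I_def using u_sum u_int h(1) by (intro integral_mono_AE) auto
    finally have "(\<Sum>j\<in>J. s j powr q) \<le> 1"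
      using I by simp
    then have "(\<Sum>j\<in>J. s j powr q) * I powr q \<le> 1 * I powr q"
      by (intro mult_right_mono) auto
    then show ?thesis
      using s0 I by (simp add: a_eq powr_mult sum_distrib_right flip: I_def)
  qed
qed

text \<open>Each \<open>m j\<close> is at most \<open>t\<close>, so
  \<open>m j powr e \<le> m j * t powr (e - 1)\<close>; summing the first factors costs one more
  \<open>t\<close>.\<close>

lemma sum_powr_le_powr_sum:
  fixes m :: "'i \<Rightarrow> real"
  assumes "finite J" and "1 \<le> e" and m: "\<And>j. j \<in> J \<Longrightarrow> 0 \<le> m j" and le: "sum m J \<le> t"
  shows "(\<Sum>j\<in>J. m j powr e) \<le> t powr e"
proof -
  have m_le: "m j \<le> t" if "j \<in> J" for j
    using member_le_sum[of j J m] that assms by auto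
  have "0 \<le> t"
    using order_trans[OF sum_nonneg le] m by blast
  have "m j powr e \<le> m j * t powr (e - 1)" if "j \<in> J" for j
    using powr_mult_base[of "m j" "e - 1"] m[OF that] m_le[OF that] \<open>1 \<le> e\<close>
      powr_mono2[of "e - 1" "m j" t]
    by (metis add.commute diff_add_cancel diff_ge_0_iff_ge mult_left_mono)
  then have "(\<Sum>j\<in>J. m j powr e) \<le> sum m J * t powr (e - 1)"
    by (simp add: sum_distrib_right sum_mono)
  also have "\<dots> \<le> t * t powr (e - 1)"
    using le by (intro mult_right_mono) auto
  also have "\<dots> = t powr e"
    using powr_mult_base[OF \<open>0 \<le> t\<close>, of "e - 1"] by simp
  finally show ?thesis .
qed

lemma lorentz_p1_real:
  fixes g :: "'a \<Rightarrow> real"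
  shows "lorentz_p1 p M (\<lambda>x. ennreal (g x)) =
    ennreal p * (\<integral>\<^sup>+y\<in>{0<..}. ennreal_pow (emeasure M {x \<in> space M. y < g x}) (1 / p) \<partial>lborel)"
proof -
  have "ennreal_pow (emeasure M {x \<in> space M. ennreal y < ennreal (g x)}) (1 / p) * indicator {0<..} y
      = ennreal_pow (emeasure M {x \<in> space M. y < g x}) (1 / p) * indicator {0<..} y" for y :: real
    by (cases "0 < y") (simp_all add: ennreal_less_iff)
  then show ?thesis
    by (simp add: lorentz_p1_def)
qed

text \<open>At each height the distribution functions of the restrictions add up to at most that of
  \<open>g\<close>. Since \<open>q / p \<ge> 1\<close>, the \<open>q\<close>-th powers of their
  \<open>p\<close>-th roots add up as well, and \<open>sum_integral_powr_le\<close> carries this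
  pointwise bound over to the integrals.\<close>

lemma (in sigma_finite_measure) sum_lorentz_p1_restrict_le:
  fixes g :: "'a \<Rightarrow> real" and Q :: "'i \<Rightarrow> 'a set"
  assumes [measurable]: "g \<in> borel_measurable M"
    and p: "1 \<le> p" and pq: "p \<le> q" and J: "finite J" "disjoint_family_on Q J"
    and Q: "\<And>j. j \<in> J \<Longrightarrow> Q j \<in> sets M"
  shows "(\<Sum>j\<in>J. ennreal_pow (lorentz_p1 p M (\<lambda>x. ennreal (g x * indicator (Q j) x))) q)
    \<le> ennreal_pow (lorentz_p1 p M (\<lambda>x. ennreal (g x))) q"
proof (cases "lorentz_p1 p M (\<lambda>x. ennreal (g x)) = top")
  case False
  note [measurable] = borel_measurable_distribution_function Q
  define D where "D = (\<lambda>A y. emeasure M {x \<in> space M. y < g x * indicator A x})"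
  define H where "H = (\<lambda>y. emeasure M {x \<in> space M. y < g x})"
  have D_eq: "D A y = emeasure M ({x \<in> space M. y < g x} \<inter> A)" if "0 < y" for A y
    unfolding D_def using that by (intro arg_cong[where f="emeasure M"]) (auto simp: indicator_def split: if_splits)
  have [measurable]: "D (Q j) \<in> borel_measurable borel" if "j \<in> J" for j
    using that unfolding D_def by measurable
  have [measurable]: "H \<in> borel_measurable borel"
    unfolding H_def by measurable
  have sum_D: "(\<Sum>j\<in>J. D (Q j) y) \<le> H y" if y: "0 < y" for y
  proof -
    have "(\<Sum>j\<in>J. D (Q j) y) = emeasure M (\<Union>j\<in>J. {x \<in> space M. y < g x} \<inter> Q j)"
      unfolding D_eq[OF y] using J Q by (intro sum_emeasure) (auto simp: disjoint_family_on_def)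
    also have "\<dots> \<le> H y"
      unfolding H_def by (intro emeasure_mono) auto
    finally show ?thesis .
  qed
  \<comment> \<open>The integrand of the norm as a real function. Nothing is lost by
    \<open>enn2real\<close>: a finite norm of \<open>g\<close> makes \<open>H\<close> finite at
    almost every positive height.\<close>
  define \<phi> where "\<phi> = (\<lambda>m (y::real). enn2real (m y) powr (1 / p) * indicator {0<..} y)"
  have H_fin: "(\<integral>\<^sup>+y\<in>{0<..}. ennreal_pow (H y) (1 / p) \<partial>lborel) \<noteq> top"
    using False p unfolding lorentz_p1_real H_def by (auto simp: ennreal_mult_eq_top_iff)
  then have AE_fin: "AE y in lborel. 0 < y \<longrightarrow> H y \<noteq> top"
    using nn_integral_PInf_AE[of "\<lambda>y. ennreal_pow (H y) (1 / p) * indicator {0<..} y" lborel]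
    by (auto elim!: eventually_mono simp: indicator_def)
  have eq: "(\<integral>\<^sup>+y\<in>{0<..}. ennreal_pow (m y) (1 / p) \<partial>lborel) = ennreal (\<integral>y. \<phi> m y \<partial>lborel)"
      and int: "integrable lborel (\<phi> m)"
    if [measurable]: "m \<in> borel_measurable borel" and m: "\<And>y. 0 < y \<Longrightarrow> m y \<le> H y" for m
  proof -
    have "AE y in lborel. ennreal_pow (m y) (1 / p) * indicator {0<..} y = ennreal (\<phi> m y)"
      using AE_fin
    proof eventually_elim
      case (elim y)
      show ?case
      proof (cases "0 < y")
        case True
        with elim m[OF True] have "m y \<noteq> top"
          by (auto simp: top_unique)
        with True show ?thesis
          by (simp add: \<phi>_def ennreal_pow_def)
      qed (simp add: \<phi>_def)
    qed
    then have e: "(\<integral>\<^sup>+y\<in>{0<..}. ennreal_pow (m y) (1 / p) \<partial>lborel) = (\<integral>\<^sup>+y. ennreal (\<phi> m y) \<partial>lborel)"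
      by (rule nn_integral_cong_AE)
    have "(\<integral>\<^sup>+y\<in>{0<..}. ennreal_pow (m y) (1 / p) \<partial>lborel)
        \<le> (\<integral>\<^sup>+y\<in>{0<..}. ennreal_pow (H y) (1 / p) \<partial>lborel)"
      using m p by (intro nn_integral_mono) (auto simp: indicator_def intro!: ennreal_pow_mono)
    with H_fin e have "(\<integral>\<^sup>+y. ennreal (\<phi> m y) \<partial>lborel) < top"
      by (auto simp: less_top top_unique)
    then show "integrable lborel (\<phi> m)"
      by (intro integrableI_nonneg) (auto simp: \<phi>_def)
    then show "(\<integral>\<^sup>+y\<in>{0<..}. ennreal_pow (m y) (1 / p) \<partial>lborel) = ennreal (\<integral>y. \<phi> m y \<partial>lborel)"
      unfolding e by (intro nn_integral_eq_integral) (auto simp: \<phi>_def)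
  qed
  have DH: "D (Q j) y \<le> H y" if "0 < y" "j \<in> J" for j y
    using that unfolding D_eq[OF that(1)] H_def by (intro emeasure_mono) auto
  have "(\<Sum>j\<in>J. (\<integral>y. \<phi> (D (Q j)) y \<partial>lborel) powr q) \<le> (\<integral>y. \<phi> H y \<partial>lborel) powr q"
  proof (rule sum_integral_powr_le[OF J(1)])
    show "AE y in lborel. (\<Sum>j\<in>J. \<phi> (D (Q j)) y powr q) \<le> \<phi> H y powr q"
      using AE_fin
    proof eventually_elim
      case (elim y)
      show ?case
      proof (cases "0 < y")
        case True
        with elim have fin: "H y \<noteq> top" by simp
        have Dfin: "D (Q j) y < top" if "j \<in> J" for j
          using DH[OF True that] fin by (auto simp: less_top top_unique)
        have "(\<Sum>j\<in>J. enn2real (D (Q j) y)) = enn2real (\<Sum>j\<in>J. D (Q j) y)"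
          using Dfin by (simp add: enn2real_sum)
        also have "\<dots> \<le> enn2real (H y)"
          using sum_D[OF True] fin by (intro enn2real_mono) (auto simp: less_top)
        finally have "(\<Sum>j\<in>J. enn2real (D (Q j) y) powr (q / p)) \<le> enn2real (H y) powr (q / p)"
          using J p pq by (intro sum_powr_le_powr_sum) (auto simp: field_simps)
        with True show ?thesis
          by (simp add: \<phi>_def powr_powr)
      qed (simp add: \<phi>_def)
    qed
  qed (use p pq int[of H] in \<open>auto simp: \<phi>_def\<close>)
  then have "p powr q * (\<Sum>j\<in>J. (\<integral>y. \<phi> (D (Q j)) y \<partial>lborel) powr q) \<le> p powr q * (\<integral>y. \<phi> H y \<partial>lborel) powr q"
    by (intro mult_left_mono) auto
  moreover have "ennreal_pow (ennreal p * ennreal (\<integral>y. \<phi> m y \<partial>lborel)) q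
      = ennreal (p powr q * (\<integral>y. \<phi> m y \<partial>lborel) powr q)" for m
    using p by (simp add: ennreal_pow_ennreal powr_mult \<phi>_def flip: ennreal_mult)
  ultimately have "(\<Sum>j\<in>J. ennreal_pow (ennreal p * ennreal (\<integral>y. \<phi> (D (Q j)) y \<partial>lborel)) q)
      \<le> ennreal_pow (ennreal p * ennreal (\<integral>y. \<phi> H y \<partial>lborel)) q"
    by (simp add: sum_ennreal ennreal_leI sum_distrib_left)
  then show ?thesis
    using eq[of H] eq[OF _ DH] by (simp add: lorentz_p1_real D_def H_def)
qed (use assms in simp)

section \<open>Cubes\<close>

lemma cube_eq_cbox: "cube c r = cbox (\<chi> i. c $ i - r / 2) (\<chi> i. c $ i + r / 2)"
proof -
  have "\<bar>a - b\<bar> \<le> r / 2 \<longleftrightarrow> b - r / 2 \<le> a \<and> a \<le> b + r / 2" for a b :: real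
    by (safe; linarith)
  then show ?thesis
    by (auto simp: cube_def mem_box_cart)
qed

lemma compact_cube: "compact (cube c r)"
  by (simp add: cube_eq_cbox compact_cbox)

lemma cube_in_sets_lebesgue [measurable, simp]: "cube c r \<in> sets lebesgue"
  by (simp add: cube_eq_cbox)

lemma cube_mono: "r \<le> s \<Longrightarrow> cube c r \<subseteq> cube c s"
  unfolding cube_def by (intro Collect_mono impI allI) (drule spec, erule order_trans, simp)

lemma mem_interior_cube: "x \<in> cube c r \<Longrightarrow> r < s \<Longrightarrow> x \<in> interior (cube c s)"
proof -
  assume x: "x \<in> cube c r" and "r < s"
  have "c $ i - s / 2 < x $ i \<and> x $ i < c $ i + s / 2" for i
  proof -
    have "\<bar>x $ i - c $ i\<bar> \<le> r / 2"
      using x by (simp add: cube_def)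
    with \<open>r < s\<close> show ?thesis
      by linarith
  qed
  then show ?thesis
    by (simp add: cube_eq_cbox interior_cbox mem_box_cart)
qed

lemma measure_cube: "0 \<le> r \<Longrightarrow> measure lebesgue (cube (c::real^'n) r) = r ^ CARD('n)"
  by (simp add: cube_eq_cbox content_cbox_if_cart interval_eq_empty_cart not_less measure_completion)

text \<open>Triangle inequality in each coordinate through a common point:
  \<open>r' / 2 + r' / 2 + r / 2 \<le> 3 * r / 2\<close>.\<close>

lemma cube_subset_cube_3:
  assumes "cube c' r' \<inter> cube c r \<noteq> {}" and "r' \<le> r"
  shows "cube c' r' \<subseteq> cube c (3 * r)"
proof
  fix x assume x: "x \<in> cube c' r'"
  obtain w where w: "w \<in> cube c' r'" "w \<in> cube c r"
    using assms by auto
  show "x \<in> cube c (3 * r)"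
    unfolding cube_def mem_Collect_eq
  proof
    fix i
    have "\<bar>x $ i - c' $ i\<bar> \<le> r' / 2" "\<bar>w $ i - c' $ i\<bar> \<le> r' / 2" "\<bar>w $ i - c $ i\<bar> \<le> r / 2"
      using x w by (auto simp: cube_def)
    with \<open>r' \<le> r\<close> show "\<bar>x $ i - c $ i\<bar> \<le> 3 * r / 2"
      by linarith
  qed
qed

text \<open>Greedy selection: a largest cube is kept, all cubes that meet it lie in its triple, and
  the induction hypothesis handles those disjoint from it.\<close>

lemma finite_cube_Vitali:
  fixes A :: "((real^'n) \<times> real) set"
  assumes "finite A"
  shows "\<exists>B\<subseteq>A. disjoint_family_on (\<lambda>(c, r). cube c r) B \<and>
    (\<Union>(c, r)\<in>A. cube c r) \<subseteq> (\<Union>(c, r)\<in>B. cube c (3 * r))"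
  using assms
proof (induction A rule: finite_psubset_induct)
  case (psubset A)
  show ?case
  proof (cases "A = {}")
    case False
    then have "Max (snd ` A) \<in> snd ` A"
      using psubset.hyps by (intro Max_in) auto
    then obtain c r where cr: "(c, r) \<in> A" "Max (snd ` A) = r"
      by force
    have r_max: "s \<le> r" if "(d, s) \<in> A" for d s
      unfolding cr(2)[symmetric] using that psubset.hyps by (intro Max_ge) (auto simp: rev_image_eqI)
    \<comment> \<open>The pair \<open>(c, r)\<close> is removed explicitly, because a cube with
      negative \<open>r\<close> is empty and hence disjoint from itself.\<close>
    define A' where "A' = {(d, s) \<in> A. (d, s) \<noteq> (c, r) \<and> cube d s \<inter> cube c r = {}}"
    have "A' \<subset> A"
      using cr by (auto simp: A'_def)
    from psubset.IH[OF this] obtain B where B: "B \<subseteq> A'" "disjoint_family_on (\<lambda>(c, r). cube c r) B"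
        "(\<Union>(c, r)\<in>A'. cube c r) \<subseteq> (\<Union>(c, r)\<in>B. cube c (3 * r))"
      by blast
    show ?thesis
    proof (intro exI[of _ "insert (c, r) B"] conjI)
      show "insert (c, r) B \<subseteq> A"
        using B(1) cr by (auto simp: A'_def)
      show "disjoint_family_on (\<lambda>(c, r). cube c r) (insert (c, r) B)"
        using B(1,2) unfolding disjoint_family_on_def A'_def by fastforce
      show "(\<Union>(c, r)\<in>A. cube c r) \<subseteq> (\<Union>(c, r)\<in>insert (c, r) B. cube c (3 * r))"
      proof
        fix x assume "x \<in> (\<Union>(c, r)\<in>A. cube c r)"
        then obtain d s where ds: "(d, s) \<in> A" "x \<in> cube d s"
          by auto
        show "x \<in> (\<Union>(c, r)\<in>insert (c, r) B. cube c (3 * r))"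
        proof (cases "(d, s) \<in> A'")
          case True
          with ds B(3) show ?thesis by auto
        next
          case False
          with ds have "cube d s \<inter> cube c r \<noteq> {}"
            by (auto simp: A'_def)
          from cube_subset_cube_3[OF this r_max[OF ds(1)]] ds(2) show ?thesis
            by auto
        qed
      qed
    qed
  qed (simp add: disjoint_family_on_def)
qed

section \<open>The normalising factor of a cube: positivity, tripling and continuity\<close>

lemma cube_factor_pos:
  assumes "critical_radius \<rho>" and "0 < r"
  shows "0 < cube_factor \<rho> \<theta> \<alpha> c r"
proof -
  have "0 < r / \<rho> c"
    using assms by (simp add: critical_radius_def)
  then show ?thesis
    using assms by (simp add: cube_factor_def psi_def measure_cube zero_less_mult_iff)
qed

text \<open>Both cubes have the same centre, so \<open>\<rho>\<close> is evaluated at one point and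
  \<open>1 + 3 * t \<le> 3 * (1 + t)\<close> compares the two values of \<open>psi\<close>. The
  outer exponent is positive because \<open>\<alpha>\<close> is below the dimension.\<close>

lemma cube_factor_3:
  fixes \<rho> :: "real^'n \<Rightarrow> real"
  assumes \<rho>: "critical_radius \<rho>" and r: "0 < r" and \<theta>: "0 \<le> \<theta>" and \<alpha>: "\<alpha> < real CARD('n)"
  shows "cube_factor \<rho> \<theta> \<alpha> c (3 * r)
    \<le> (3 ^ CARD('n) * 3 powr \<theta>) powr (1 - \<alpha> / real CARD('n)) * cube_factor \<rho> \<theta> \<alpha> c r"
proof -
  have "0 < \<rho> c"
    using \<rho> by (simp add: critical_radius_def)
  with r have "0 < r / \<rho> c"
    by simp
  then have "(1 + 3 * r / \<rho> c) powr \<theta> \<le> (3 * (1 + r / \<rho> c)) powr \<theta>"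
    using \<theta> by (intro powr_mono2) auto
  also have "\<dots> = 3 powr \<theta> * (1 + r / \<rho> c) powr \<theta>"
    by (rule powr_mult)
  finally have "measure lebesgue (cube c (3 * r)) * psi \<rho> \<theta> c (3 * r)
      \<le> measure lebesgue (cube c (3 * r)) * (3 powr \<theta> * psi \<rho> \<theta> c r)"
    unfolding psi_def by (intro mult_left_mono) auto
  also have "\<dots> = (3 ^ CARD('n) * 3 powr \<theta>) * (measure lebesgue (cube c r) * psi \<rho> \<theta> c r)"
    using r by (simp add: measure_cube power_mult_distrib)
  finally have "cube_factor \<rho> \<theta> \<alpha> c (3 * r)
      \<le> ((3 ^ CARD('n) * 3 powr \<theta>) * (measure lebesgue (cube c r) * psi \<rho> \<theta> c r)) powr (1 - \<alpha> / real CARD('n))"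
    unfolding cube_factor_def using \<alpha> by (intro powr_mono2) (auto simp: psi_def)
  then show ?thesis
    by (simp add: cube_factor_def powr_mult psi_def)
qed

lemma continuous_cube_factor:
  fixes \<rho> :: "real^'n \<Rightarrow> real"
  assumes \<rho>: "critical_radius \<rho>" and r: "0 < r"
  shows "(cube_factor \<rho> \<theta> \<alpha> c \<longlongrightarrow> cube_factor \<rho> \<theta> \<alpha> c r) (at_right r)"
proof -
  have \<rho>c: "0 < \<rho> c"
    using \<rho> by (simp add: critical_radius_def)
  let ?F = "\<lambda>s. (s ^ CARD('n) * (1 + s / \<rho> c) powr \<theta>) powr (1 - \<alpha> / real CARD('n))"
  have "0 < r / \<rho> c"
    using r \<rho>c by simp
  then have "r ^ CARD('n) * (1 + r / \<rho> c) powr \<theta> \<noteq> 0" "1 + r / \<rho> c \<noteq> 0"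
    using r by auto
  with \<rho>c have "(?F \<longlongrightarrow> ?F r) (at_right r)"
    by (intro tendsto_intros) auto
  moreover have "eventually (\<lambda>s. ?F s = cube_factor \<rho> \<theta> \<alpha> c s) (at_right r)"
    using r by (auto simp: eventually_at_right_field cube_factor_def psi_def measure_cube intro!: exI[of _ "r + 1"])
  ultimately have "(cube_factor \<rho> \<theta> \<alpha> c \<longlongrightarrow> ?F r) (at_right r)"
    by (rule Lim_transform_eventually)
  then show ?thesis
    using r by (simp add: cube_factor_def psi_def measure_cube)
qed

section \<open>Level sets of the maximal function\<close>

text \<open>A supremum exceeds \<open>t\<close> exactly when one of its terms does, and the factor,
  being positive and finite, can be multiplied out even if the integral is infinite.\<close>

lemma less_maximal_fun_iff:
  assumes \<rho>: "critical_radius \<rho>"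
  shows "t < maximal_fun \<rho> \<theta> \<alpha> f x \<longleftrightarrow> (\<exists>c r. 0 < r \<and> x \<in> cube c r \<and>
    t * ennreal (cube_factor \<rho> \<theta> \<alpha> c r) < (\<integral>\<^sup>+y\<in>cube c r. ennreal \<bar>f y\<bar> \<partial>lebesgue))"
proof -
  have "t < a / ennreal (cube_factor \<rho> \<theta> \<alpha> c r) \<longleftrightarrow> t * ennreal (cube_factor \<rho> \<theta> \<alpha> c r) < a"
    if r: "0 < r" for c r a
  proof -
    let ?F = "ennreal (cube_factor \<rho> \<theta> \<alpha> c r)"
    have F: "0 < ?F" "?F < top"
      using cube_factor_pos[OF \<rho> r] by auto
    then have FF: "?F / ?F = 1"
      by (intro ennreal_divide_self) auto
    have "a / ?F \<le> t \<longleftrightarrow> a \<le> t * ?F"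
    proof
      assume "a / ?F \<le> t"
      from mult_right_mono[OF this, of ?F] show "a \<le> t * ?F"
        by (simp add: ennreal_divide_times FF)
    qed (use F in \<open>auto intro: divide_le_posI_ennreal simp: mult.commute\<close>)
    then show ?thesis
      by (simp add: not_le[symmetric])
  qed
  then show ?thesis
    unfolding maximal_fun_def less_SUP_iff by fastforce
qed

text \<open>Slightly enlarging a closed cube puts the point into its interior and, the factor being
  continuous in the side length, keeps the strict inequality.\<close>

lemma less_maximal_fun_interior:
  assumes \<rho>: "critical_radius \<rho>" and x: "t < maximal_fun \<rho> \<theta> \<alpha> f x"
  obtains c r where "0 < r" "x \<in> interior (cube c r)"
    "t * ennreal (cube_factor \<rho> \<theta> \<alpha> c r) < (\<integral>\<^sup>+y\<in>cube c r. ennreal \<bar>f y\<bar> \<partial>lebesgue)"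
proof -
  from x obtain c r where cr: "0 < r" "x \<in> cube c r"
      "t * ennreal (cube_factor \<rho> \<theta> \<alpha> c r) < (\<integral>\<^sup>+y\<in>cube c r. ennreal \<bar>f y\<bar> \<partial>lebesgue)"
    by (auto simp: less_maximal_fun_iff[OF \<rho>])
  \<comment> \<open>Finiteness of \<open>t\<close> is what makes multiplication by \<open>t\<close>
    continuous on \<open>ennreal\<close>.\<close>
  have "t < top"
    using x by (simp add: less_top[symmetric]) (metis not_top_less)
  then have "((\<lambda>s. t * ennreal (cube_factor \<rho> \<theta> \<alpha> c s)) \<longlongrightarrow> t * ennreal (cube_factor \<rho> \<theta> \<alpha> c r)) (at_right r)"
    by (intro ennreal_tendsto_cmult tendsto_ennrealI continuous_cube_factor[OF \<rho> cr(1)]) auto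
  from order_tendstoD(2)[OF this cr(3)]
  have "eventually (\<lambda>s. t * ennreal (cube_factor \<rho> \<theta> \<alpha> c s) < (\<integral>\<^sup>+y\<in>cube c r. ennreal \<bar>f y\<bar> \<partial>lebesgue)) (at_right r)" .
  moreover have "eventually (\<lambda>s. r < s) (at_right r)"
    by (simp add: eventually_at_filter)
  ultimately have "eventually (\<lambda>s. r < s \<and>
      t * ennreal (cube_factor \<rho> \<theta> \<alpha> c s) < (\<integral>\<^sup>+y\<in>cube c r. ennreal \<bar>f y\<bar> \<partial>lebesgue)) (at_right r)"
    by eventually_elim auto
  then obtain s where s: "r < s"
      "t * ennreal (cube_factor \<rho> \<theta> \<alpha> c s) < (\<integral>\<^sup>+y\<in>cube c r. ennreal \<bar>f y\<bar> \<partial>lebesgue)"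
    using eventually_happens[of _ "at_right r"] trivial_limit_at_right_real[of r] by blast
  note s(2)
  also have "(\<integral>\<^sup>+y\<in>cube c r. ennreal \<bar>f y\<bar> \<partial>lebesgue) \<le> (\<integral>\<^sup>+y\<in>cube c s. ennreal \<bar>f y\<bar> \<partial>lebesgue)"
    using cube_mono[of r s c] s(1) by (intro nn_integral_mono mult_left_mono) (auto simp: indicator_def)
  finally show ?thesis
    using that[of s c] s(1) cr mem_interior_cube by force
qed

text \<open>A cube with large average puts all of its points into the level set, in particular its
  interior. Openness also yields measurability of the level sets.\<close>

lemma open_less_maximal_fun:
  assumes \<rho>: "critical_radius \<rho>"
  shows "open {x. t < maximal_fun \<rho> \<theta> \<alpha> f x}"
proof (subst open_subopen, intro ballI)
  fix x assume "x \<in> {x. t < maximal_fun \<rho> \<theta> \<alpha> f x}"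
  then obtain c r where cr: "0 < r" "x \<in> interior (cube c r)"
      "t * ennreal (cube_factor \<rho> \<theta> \<alpha> c r) < (\<integral>\<^sup>+y\<in>cube c r. ennreal \<bar>f y\<bar> \<partial>lebesgue)"
    using less_maximal_fun_interior[OF \<rho>] by blast
  have "y \<in> {x. t < maximal_fun \<rho> \<theta> \<alpha> f x}" if "y \<in> interior (cube c r)" for y
    using that cr interior_subset[of "cube c r"] by (auto simp: less_maximal_fun_iff[OF \<rho>])
  then show "\<exists>T. open T \<and> x \<in> T \<and> T \<subseteq> {x. t < maximal_fun \<rho> \<theta> \<alpha> f x}"
    using cr(2) by (intro exI[of _ "interior (cube c r)"]) auto
qed

section \<open>Weights\<close>

lemma sets_weight_measure [measurable_cong, simp]: "sets (weight_measure w) = sets lebesgue"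
  by (simp add: weight_measure_def)

lemma space_weight_measure [simp]: "space (weight_measure w) = UNIV"
  by (simp add: weight_measure_def)

lemma emeasure_weight_measure_compact:
  assumes w: "weight w" and K: "compact K"
  shows "emeasure (weight_measure w) K < \<infinity>"
proof -
  have [measurable]: "w \<in> borel_measurable lebesgue"
    using w by (simp add: weight_def)
  have "K \<in> sets lebesgue"
    using K by (simp add: borel_compact)
  then have "emeasure (weight_measure w) K = (\<integral>\<^sup>+x\<in>K. ennreal (w x) \<partial>lebesgue)"
    unfolding weight_measure_def by (intro emeasure_density) auto
  also have "\<dots> \<le> (\<integral>\<^sup>+x. ennreal (norm (indicator K x *\<^sub>R w x)) \<partial>lebesgue)"
    by (intro nn_integral_mono) (auto simp: indicator_def ennreal_leI)
  also have "\<dots> < \<infinity>"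
    using w K by (auto simp: weight_def set_integrable_def integrable_iff_bounded)
  finally show ?thesis .
qed

lemma sigma_finite_weight_measure: "weight w \<Longrightarrow> sigma_finite_measure (weight_measure w)"
  by (rule sigma_finite_measure_compact) (use emeasure_weight_measure_compact in auto)

text \<open>The density cancels against \<open>inverse (w x)\<close> wherever \<open>w x\<close> is
  positive, that is, almost everywhere.\<close>

lemma nn_integral_weight_measure_inverse:
  assumes w: "weight w" and [measurable]: "P \<in> sets lebesgue" "Q \<in> sets lebesgue"
  shows "(\<integral>\<^sup>+x\<in>P. ennreal (indicator Q x * inverse (w x)) \<partial>weight_measure w) = emeasure lebesgue (P \<inter> Q)"
proof -
  have [measurable]: "w \<in> borel_measurable lebesgue"
    using w by (simp add: weight_def)
  have "(\<integral>\<^sup>+x\<in>P. ennreal (indicator Q x * inverse (w x)) \<partial>weight_measure w)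
      = (\<integral>\<^sup>+x. ennreal (w x) * (ennreal (indicator Q x * inverse (w x)) * indicator P x) \<partial>lebesgue)"
    unfolding weight_measure_def by (intro nn_integral_density) auto
  also have "\<dots> = (\<integral>\<^sup>+x. indicator (P \<inter> Q) x \<partial>lebesgue)"
  proof (rule nn_integral_cong_AE)
    have "AE x in lebesgue. 0 < w x"
      using w by (simp add: weight_def)
    then show "AE x in lebesgue. ennreal (w x) * (ennreal (indicator Q x * inverse (w x)) * indicator P x)
        = indicator (P \<inter> Q) x"
      by eventually_elim (auto simp: indicator_def simp flip: ennreal_mult)
  qed
  finally show ?thesis
    by simp
qed

text \<open>The Lebesgue measure of \<open>P\<close> is the integral of \<open>inverse (w x)\<close>
  over \<open>P\<close> with respect to the weight measure, which vanishes on null sets.\<close>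

lemma weight_measure_null_imp_lebesgue_null:
  assumes w: "weight w" and [measurable]: "P \<in> sets lebesgue" and P: "emeasure (weight_measure w) P = 0"
  shows "emeasure lebesgue P = 0"
proof -
  have "(\<integral>\<^sup>+x\<in>P. ennreal (indicator UNIV x * inverse (w x)) \<partial>weight_measure w) = 0"
    using P by (intro nn_integral_null_set) (simp add: null_sets_def)
  then show ?thesis
    using nn_integral_weight_measure_inverse[OF w, of P UNIV] by simp
qed

section \<open>The two forms of the two-weight condition\<close>

context
  fixes w :: "real^'n \<Rightarrow> real" and p F :: real and Q :: "(real^'n) set"
  assumes w: "weight w" and p: "1 \<le> p" and F: "0 < F" and Q: "Q \<in> sets lebesgue"
begin

lemma borel_measurable_restrict_inverse_weight:
  "(\<lambda>x. indicator Q x * inverse (w x)) \<in> borel_measurable (weight_measure w)"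
proof -
  have [measurable]: "w \<in> borel_measurable lebesgue" "Q \<in> sets lebesgue"
    using w Q by (simp_all add: weight_def)
  show ?thesis
    by measurable
qed

lemma emeasure_Int_le_lorentz_weak:
  assumes P: "P \<in> sets lebesgue" "0 < emeasure (weight_measure w) P" "emeasure (weight_measure w) P < \<infinity>"
  shows "emeasure lebesgue (P \<inter> Q) / ennreal F * inverse (ennreal_pow (emeasure (weight_measure w) P) (1 / p))
    \<le> ennreal p * (lorentz_weak (conj_exponent p) (weight_measure w)
          (\<lambda>x. ennreal (indicator Q x * inverse (w x))) / ennreal F)"
proof -
  interpret sigma_finite_measure "weight_measure w"
    by (rule sigma_finite_weight_measure[OF w])
  let ?L = "lorentz_weak (conj_exponent p) (weight_measure w) (\<lambda>x. ennreal (indicator Q x * inverse (w x)))"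
  let ?X = "ennreal_pow (emeasure (weight_measure w) P) (1 / p)"
  have "emeasure lebesgue (P \<inter> Q) \<le> ennreal p * ?L * ?X"
    using Lorentz_Hoelder[OF borel_measurable_restrict_inverse_weight _ p, of P] P
    by (simp add: nn_integral_weight_measure_inverse[OF w P(1) Q])
  then have "emeasure lebesgue (P \<inter> Q) / ennreal F * inverse ?X \<le> ennreal p * ?L * ?X / ennreal F * inverse ?X"
    by (intro mult_right_mono divide_right_mono_ennreal) auto
  also have "\<dots> = ennreal p * (?L / ennreal F) * (?X * inverse ?X)"
    by (simp add: divide_ennreal_def ac_simps)
  also have "?X * inverse ?X = 1"
    using P by (intro ennreal_mult_inverse_pow) auto
  finally show ?thesis
    by simp
qed

text \<open>The restricted inverse weight has integral \<open>emeasure lebesgue Q\<close>, so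
  \<open>Q_fin\<close> is the integrability required for testing on level sets. The factor
  \<open>F\<close> is moved to the right and absorbed into the bound.\<close>

lemma lorentz_weak_le_SUP_emeasure_Int:
  assumes Q_fin: "emeasure lebesgue Q < \<infinity>"
  shows "lorentz_weak (conj_exponent p) (weight_measure w) (\<lambda>x. ennreal (indicator Q x * inverse (w x))) / ennreal F
    \<le> (SUP P \<in> {P \<in> sets lebesgue. 0 < emeasure (weight_measure w) P \<and> emeasure (weight_measure w) P < \<infinity>}.
        emeasure lebesgue (P \<inter> Q) / ennreal F * inverse (ennreal_pow (emeasure (weight_measure w) P) (1 / p)))"
    (is "?L / _ \<le> ?S")
proof -
  have "?L \<le> ennreal F * ?S"
  proof (rule lorentz_weak_le_of_restricted_bound[OF borel_measurable_restrict_inverse_weight p])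
    show "(\<integral>\<^sup>+x. ennreal (indicator Q x * inverse (w x)) \<partial>weight_measure w) < \<infinity>"
      using nn_integral_weight_measure_inverse[OF w _ Q, of UNIV] Q_fin by simp
    fix P assume P: "P \<in> sets (weight_measure w)" "0 < emeasure (weight_measure w) P"
      "emeasure (weight_measure w) P < \<infinity>"
    let ?X = "inverse (ennreal_pow (emeasure (weight_measure w) P) (1 / p))"
    have FF: "ennreal F * inverse (ennreal F) = 1"
      using F by (simp add: inverse_ennreal flip: ennreal_mult)
    have "(\<integral>\<^sup>+x\<in>P. ennreal (indicator Q x * inverse (w x)) \<partial>weight_measure w) * ?X
        = (ennreal F * inverse (ennreal F)) * (emeasure lebesgue (P \<inter> Q) * ?X)"
      using P by (simp add: FF nn_integral_weight_measure_inverse[OF w _ Q])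
    also have "\<dots> = ennreal F * (emeasure lebesgue (P \<inter> Q) / ennreal F * ?X)"
      by (simp add: divide_ennreal_def ac_simps)
    also have "\<dots> \<le> ennreal F * ?S"
      using P by (intro mult_left_mono SUP_upper) auto
    finally show "(\<integral>\<^sup>+x\<in>P. ennreal (indicator Q x * inverse (w x)) \<partial>weight_measure w) * ?X \<le> ennreal F * ?S" .
  qed
  then show ?thesis
    using F by (intro divide_le_posI_ennreal) auto
qed

end

lemma emeasure_lebesgue_cube_finite: "emeasure lebesgue (cube c r) < \<infinity>"
  using emeasure_compact_finite[OF compact_cube[of c r]]
  by (simp add: emeasure_completion compact_cube borel_compact)

lemma A_R_norm_le_A_R_const:
  fixes \<rho> \<mu> \<nu> :: "real^'n \<Rightarrow> real"
  assumes \<rho>: "critical_radius \<rho>" and \<mu>: "weight \<mu>" and p: "1 \<le> p"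
  shows "A_R_norm \<rho> \<theta> \<alpha> p q \<mu> \<nu> \<le> ennreal p * A_R_const \<rho> \<theta> \<alpha> p q \<mu> \<nu>"
  unfolding A_R_norm_def
proof (rule SUP_least, clarify)
  fix c :: "real^'n" and r :: real assume r: "0 < r"
  let ?V = "ennreal_pow (emeasure (weight_measure \<nu>) (cube c r)) (1 / q)"
  let ?L = "lorentz_weak (conj_exponent p) (weight_measure \<mu>)
      (\<lambda>x. ennreal (indicator (cube c r) x * inverse (\<mu> x))) / ennreal (cube_factor \<rho> \<theta> \<alpha> c r)"
  let ?S = "SUP P \<in> {P \<in> sets lebesgue. 0 < emeasure (weight_measure \<mu>) P \<and> emeasure (weight_measure \<mu>) P < \<infinity>}.
      emeasure lebesgue (P \<inter> cube c r) / ennreal (cube_factor \<rho> \<theta> \<alpha> c r)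
        * inverse (ennreal_pow (emeasure (weight_measure \<mu>) P) (1 / p))"
  have "?V * ?S \<le> ?V * (ennreal p * ?L)"
    using cube_factor_pos[OF \<rho>, of r] r
    by (intro mult_left_mono SUP_least emeasure_Int_le_lorentz_weak \<mu> p) auto
  also have "\<dots> = ennreal p * (?V * ?L)"
    by (simp add: ac_simps)
  also have "\<dots> \<le> ennreal p * A_R_const \<rho> \<theta> \<alpha> p q \<mu> \<nu>"
    unfolding A_R_const_def using r by (intro mult_left_mono SUP_upper2[of "(c, r)"]) auto
  finally show "?V * ?S \<le> ennreal p * A_R_const \<rho> \<theta> \<alpha> p q \<mu> \<nu>" .
qed

lemma A_R_const_le_A_R_norm:
  assumes \<rho>: "critical_radius \<rho>" and \<mu>: "weight \<mu>" and p: "1 \<le> p"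
  shows "A_R_const \<rho> \<theta> \<alpha> p q \<mu> \<nu> \<le> A_R_norm \<rho> \<theta> \<alpha> p q \<mu> \<nu>"
  unfolding A_R_const_def A_R_norm_def
proof (rule SUP_subset_mono[OF order_refl], clarify)
  fix c and r :: real assume "0 < r"
  then show "ennreal_pow (emeasure (weight_measure \<nu>) (cube c r)) (1 / q) *
        (lorentz_weak (conj_exponent p) (weight_measure \<mu>)
          (\<lambda>x. ennreal (indicator (cube c r) x * inverse (\<mu> x))) / ennreal (cube_factor \<rho> \<theta> \<alpha> c r))
      \<le> ennreal_pow (emeasure (weight_measure \<nu>) (cube c r)) (1 / q) *
        (SUP P \<in> {P \<in> sets lebesgue. 0 < emeasure (weight_measure \<mu>) P \<and> emeasure (weight_measure \<mu>) P < \<infinity>}.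
           emeasure lebesgue (P \<inter> cube c r) / ennreal (cube_factor \<rho> \<theta> \<alpha> c r)
             * inverse (ennreal_pow (emeasure (weight_measure \<mu>) P) (1 / p)))"
    using cube_factor_pos[OF \<rho>, of r]
    by (intro mult_left_mono lorentz_weak_le_SUP_emeasure_Int \<mu> p emeasure_lebesgue_cube_finite) auto
qed

text \<open>Free of division, the condition extends to all measurable \<open>P\<close>: if
  \<open>P\<close> is null for \<open>\<mu>\<close> it is Lebesgue null and the left side is 0, and
  if its measure is infinite so is the right side, as \<open>S\<close> and the factor are
  positive.\<close>

lemma emeasure_le_of_A_R_norm:
  fixes \<rho> \<mu> \<nu> :: "real^'n \<Rightarrow> real"
  assumes \<rho>: "critical_radius \<rho>" and \<mu>: "weight \<mu>" and p: "1 \<le> p"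
    and S: "A_R_norm \<rho> \<theta> \<alpha> p q \<mu> \<nu> \<le> ennreal S" "0 < S" and r: "0 < r" and P: "P \<in> sets lebesgue"
  shows "ennreal_pow (emeasure (weight_measure \<nu>) (cube c r)) (1 / q) * emeasure lebesgue (P \<inter> cube c r)
    \<le> ennreal (S * cube_factor \<rho> \<theta> \<alpha> c r) * ennreal_pow (emeasure (weight_measure \<mu>) P) (1 / p)"
proof -
  define F where "F = cube_factor \<rho> \<theta> \<alpha> c r"
  have F: "0 < F"
    unfolding F_def by (rule cube_factor_pos[OF \<rho> r])
  let ?m = "emeasure (weight_measure \<mu>) P"
  let ?V = "ennreal_pow (emeasure (weight_measure \<nu>) (cube c r)) (1 / q)"
  consider "?m = 0" | "?m = top" | "0 < ?m" "?m < \<infinity>"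
    by (cases "?m = 0"; cases "?m = top") (auto simp: less_top zero_less_iff_neq_zero)
  then show ?thesis
  proof cases
    case 1
    have "emeasure lebesgue (P \<inter> cube c r) \<le> emeasure lebesgue P"
      using P by (intro emeasure_mono) auto
    then have "emeasure lebesgue (P \<inter> cube c r) = 0"
      using weight_measure_null_imp_lebesgue_null[OF \<mu> P 1] by simp
    then show ?thesis by simp
  next
    case 2
    then show ?thesis
      using F S by (simp add: ennreal_mult_top F_def[symmetric])
  next
    case 3
    let ?X = "ennreal_pow ?m (1 / p)"
    let ?T = "\<lambda>P. emeasure lebesgue (P \<inter> cube c r) / ennreal F
        * inverse (ennreal_pow (emeasure (weight_measure \<mu>) P) (1 / p))"
    have "?V * ?T P \<le> ?V * (SUP P \<in> {P \<in> sets lebesgue. 0 < emeasure (weight_measure \<mu>) P \<and>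
        emeasure (weight_measure \<mu>) P < \<infinity>}. ?T P)"
      using 3 P by (intro mult_left_mono SUP_upper) auto
    also have "\<dots> \<le> A_R_norm \<rho> \<theta> \<alpha> p q \<mu> \<nu>"
      unfolding A_R_norm_def F_def using r by (intro SUP_upper2[of "(c, r)"]) auto
    finally have "?V * ?T P \<le> ennreal S"
      using S by simp
    then have "?V * ?T P * (ennreal F * ?X) \<le> ennreal S * (ennreal F * ?X)"
      by (intro mult_right_mono) auto
    moreover have "?V * ?T P * (ennreal F * ?X)
        = ?V * emeasure lebesgue (P \<inter> cube c r) * (ennreal F * inverse (ennreal F)) * (?X * inverse ?X)"
      by (simp add: divide_ennreal_def ac_simps)
    moreover have "ennreal F * inverse (ennreal F) = 1"
      using F by (simp add: inverse_ennreal flip: ennreal_mult)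
    moreover have "?X * inverse ?X = 1"
      using 3 by (intro ennreal_mult_inverse_pow) auto
    ultimately show ?thesis
      using F S by (simp add: ennreal_mult mult.assoc flip: F_def)
  qed
qed

section \<open>The weak type estimate\<close>

text \<open>An inequality for sets is applied to the level sets of \<open>\<bar>f\<bar>\<close>
  inside \<open>Q\<close> and integrated over the height; the layer cake formula recovers the
  integral on the left.\<close>

lemma nn_integral_restrict_le_lorentz_p1:
  fixes f :: "real^'n \<Rightarrow> real"
  assumes w: "weight w" and p: "1 \<le> p"
    and [measurable]: "Q \<in> sets lebesgue" "f \<in> borel_measurable lebesgue"
    and le: "\<And>P. P \<in> sets lebesgue \<Longrightarrow> P \<subseteq> Q \<Longrightarrow>
      V * emeasure lebesgue P \<le> B * ennreal_pow (emeasure (weight_measure w) P) (1 / p)"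
  shows "V * (\<integral>\<^sup>+x\<in>Q. ennreal \<bar>f x\<bar> \<partial>lebesgue)
    \<le> B * lorentz_p1 p (weight_measure w) (\<lambda>x. ennreal (\<bar>f x\<bar> * indicator Q x))"
proof -
  interpret L: sigma_finite_measure "lebesgue :: (real^'n) measure"
    by (rule sigma_finite_lebesgue)
  interpret W: sigma_finite_measure "weight_measure w"
    by (rule sigma_finite_weight_measure[OF w])
  let ?E = "\<lambda>y. {x. y < \<bar>f x\<bar> * indicator Q x}"
  have [measurable]: "(\<lambda>y. emeasure lebesgue (?E y)) \<in> borel_measurable borel"
    using L.borel_measurable_distribution_function[of "\<lambda>x. \<bar>f x\<bar> * indicator Q x"] by simp
  have [measurable]: "(\<lambda>y. emeasure (weight_measure w) (?E y)) \<in> borel_measurable borel"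
    using W.borel_measurable_distribution_function[of "\<lambda>x. \<bar>f x\<bar> * indicator Q x"] by simp
  have "(\<integral>\<^sup>+x\<in>Q. ennreal \<bar>f x\<bar> \<partial>lebesgue) = (\<integral>\<^sup>+x. ennreal (\<bar>f x\<bar> * indicator Q x) \<partial>lebesgue)"
    by (intro nn_integral_cong) (auto simp: indicator_def)
  also have "\<dots> = (\<integral>\<^sup>+y\<in>{0<..}. emeasure lebesgue (?E y) \<partial>lborel)"
    by (subst L.nn_integral_layer_cake) auto
  finally have "V * (\<integral>\<^sup>+x\<in>Q. ennreal \<bar>f x\<bar> \<partial>lebesgue)
      = (\<integral>\<^sup>+y. V * (emeasure lebesgue (?E y) * indicator {0<..} y) \<partial>lborel)"
    by (simp add: nn_integral_cmult)
  also have "\<dots> \<le> (\<integral>\<^sup>+y. B * (ennreal_pow (emeasure (weight_measure w) (?E y)) (1 / p) * indicator {0<..} y) \<partial>lborel)"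
  proof (intro nn_integral_mono)
    fix y :: real
    show "V * (emeasure lebesgue (?E y) * indicator {0<..} y)
        \<le> B * (ennreal_pow (emeasure (weight_measure w) (?E y)) (1 / p) * indicator {0<..} y)"
    proof (cases "0 < y")
      case True
      have "?E y = {x \<in> space lebesgue. y < \<bar>f x\<bar> * indicator Q x}"
        by simp
      also have "\<dots> \<in> sets lebesgue"
        by measurable
      finally have "?E y \<in> sets lebesgue" .
      moreover have "?E y \<subseteq> Q"
        using True by (auto simp: indicator_def split: if_splits)
      ultimately show ?thesis
        using le[of "?E y"] True by simp
    qed simp
  qed
  also have "\<dots> = B * (\<integral>\<^sup>+y\<in>{0<..}. ennreal_pow (emeasure (weight_measure w) (?E y)) (1 / p) \<partial>lborel)"
    by (simp add: nn_integral_cmult)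
  \<comment> \<open>The factor \<open>p \<ge> 1\<close> from the definition of the norm is inserted
    here.\<close>
  also have "\<dots> \<le> B * (ennreal p * (\<integral>\<^sup>+y\<in>{0<..}. ennreal_pow (emeasure (weight_measure w) (?E y)) (1 / p) \<partial>lborel))"
    using p mult_right_mono[of 1 "ennreal p"] by (intro mult_left_mono) auto
  finally show ?thesis
    by (simp add: lorentz_p1_real)
qed

text \<open>The hypothesis pairs \<open>\<nu>\<close> on the tripled cube with test sets inside the
  original one: the tripled cubes cover the level set, while the original ones are disjoint.\<close>

lemma weak_type_of_local_bound:
  fixes \<rho> \<mu> \<nu> f :: "real^'n \<Rightarrow> real"
  assumes \<rho>: "critical_radius \<rho>" and \<mu>: "weight \<mu>" and \<nu>: "weight \<nu>"
    and p: "1 \<le> p" "p \<le> q" and K: "0 < K"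
    and f [measurable]: "f \<in> borel_measurable lebesgue"
    and bound: "\<And>c r P. 0 < r \<Longrightarrow> P \<in> sets lebesgue \<Longrightarrow> P \<subseteq> cube c r \<Longrightarrow>
      ennreal_pow (emeasure (weight_measure \<nu>) (cube c (3 * r))) (1 / q) * emeasure lebesgue P
        \<le> ennreal (K * cube_factor \<rho> \<theta> \<alpha> c r) * ennreal_pow (emeasure (weight_measure \<mu>) P) (1 / p)"
  shows "lorentz_weak (ereal q) (weight_measure \<nu>) (maximal_fun \<rho> \<theta> \<alpha> f)
    \<le> ennreal K * lorentz_p1 p (weight_measure \<mu>) (\<lambda>x. ennreal \<bar>f x\<bar>)"
proof -
  interpret W: sigma_finite_measure "weight_measure \<mu>"
    by (rule sigma_finite_weight_measure[OF \<mu>])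
  let ?N = "weight_measure \<nu>"
  let ?L = "\<lambda>Q. lorentz_p1 p (weight_measure \<mu>) (\<lambda>x. ennreal (\<bar>f x\<bar> * indicator Q x))"
  let ?R = "ennreal (K powr q) * ennreal_pow (lorentz_p1 p (weight_measure \<mu>) (\<lambda>x. ennreal \<bar>f x\<bar>)) q"
  have q: "0 < q"
    using p by simp
  have cube_bound: "ennreal (t powr q) * emeasure ?N (cube c (3 * r)) \<le> ennreal (K powr q) * ennreal_pow (?L (cube c r)) q"
    if t: "0 < t" and r: "0 < r"
      and less: "ennreal t * ennreal (cube_factor \<rho> \<theta> \<alpha> c r) < (\<integral>\<^sup>+y\<in>cube c r. ennreal \<bar>f y\<bar> \<partial>lebesgue)"
    for t c r
  proof -
    define F where "F = cube_factor \<rho> \<theta> \<alpha> c r"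
    have F: "0 < F"
      unfolding F_def by (rule cube_factor_pos[OF \<rho> r])
    let ?V = "ennreal_pow (emeasure ?N (cube c (3 * r))) (1 / q)"
    have "ennreal F * (ennreal t * ?V) = ?V * (ennreal t * ennreal F)"
      by (simp add: ac_simps)
    also have "\<dots> \<le> ?V * (\<integral>\<^sup>+y\<in>cube c r. ennreal \<bar>f y\<bar> \<partial>lebesgue)"
      using less by (intro mult_left_mono) (auto simp: F_def)
    also have "\<dots> \<le> ennreal (K * F) * ?L (cube c r)"
      unfolding F_def by (intro nn_integral_restrict_le_lorentz_p1 \<mu> p bound r) auto
    also have "\<dots> = ennreal F * (ennreal K * ?L (cube c r))"
      using F K by (simp add: ennreal_mult ac_simps)
    finally have "ennreal t * ?V \<le> ennreal K * ?L (cube c r)"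
      using F by (subst (asm) ennreal_mult_le_mult_iff) auto
    \<comment> \<open>Taking \<open>q\<close>-th powers turns the estimate into one for the measure
      of the tripled cube, which can be summed over a cover.\<close>
    then have "ennreal_pow (ennreal t * ?V) q \<le> ennreal_pow (ennreal K * ?L (cube c r)) q"
      using q by (intro ennreal_pow_mono) auto
    then show ?thesis
      using t K q by (simp add: ennreal_pow_cmult ennreal_pow_powr_inverse)
  qed
  have compact_bound: "ennreal (t powr q) * emeasure ?N C \<le> ?R"
    if t: "0 < t" and C: "compact C" "C \<subseteq> {x. ennreal t < maximal_fun \<rho> \<theta> \<alpha> f x}" for t C
  proof -
    define G where "G = {(c, r). 0 < r \<and>
      ennreal t * ennreal (cube_factor \<rho> \<theta> \<alpha> c r) < (\<integral>\<^sup>+y\<in>cube c r. ennreal \<bar>f y\<bar> \<partial>lebesgue)}"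
    \<comment> \<open>Interiors provide the open cover that compactness asks for; the closed cubes
      return once the subcover is finite.\<close>
    have "C \<subseteq> (\<Union>(c, r)\<in>G. interior (cube c r))"
    proof
      fix x assume "x \<in> C"
      with C(2) have "ennreal t < maximal_fun \<rho> \<theta> \<alpha> f x"
        by auto
      from less_maximal_fun_interior[OF \<rho> this] show "x \<in> (\<Union>(c, r)\<in>G. interior (cube c r))"
        unfolding G_def by blast
    qed
    then obtain A where A: "A \<subseteq> G" "finite A" "C \<subseteq> (\<Union>(c, r)\<in>A. interior (cube c r))"
      using compactE_image[OF C(1), of G "\<lambda>(c, r). interior (cube c r)"] by (auto simp: case_prod_unfold)
    from finite_cube_Vitali[OF A(2)] obtain B where B: "B \<subseteq> A" "disjoint_family_on (\<lambda>(c, r). cube c r) B"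
        "(\<Union>(c, r)\<in>A. cube c r) \<subseteq> (\<Union>(c, r)\<in>B. cube c (3 * r))"
      by blast
    have fB: "finite B"
      using A B finite_subset by blast
    have BG: "0 < snd z \<and> ennreal t * ennreal (cube_factor \<rho> \<theta> \<alpha> (fst z) (snd z))
        < (\<integral>\<^sup>+y\<in>cube (fst z) (snd z). ennreal \<bar>f y\<bar> \<partial>lebesgue)" if "z \<in> B" for z
      using that A B by (auto simp: G_def)
    have "C \<subseteq> (\<Union>(c, r)\<in>A. cube c r)"
      using A(3) interior_subset by fastforce
    with B(3) have "C \<subseteq> (\<Union>z\<in>B. cube (fst z) (3 * snd z))"
      by (auto simp: case_prod_unfold)
    then have "emeasure ?N C \<le> emeasure ?N (\<Union>z\<in>B. cube (fst z) (3 * snd z))"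
      using fB by (intro emeasure_mono) auto
    also have "\<dots> \<le> (\<Sum>z\<in>B. emeasure ?N (cube (fst z) (3 * snd z)))"
      using fB by (intro emeasure_subadditive_finite) auto
    finally have "ennreal (t powr q) * emeasure ?N C
        \<le> ennreal (t powr q) * (\<Sum>z\<in>B. emeasure ?N (cube (fst z) (3 * snd z)))"
      by (intro mult_left_mono) auto
    also have "\<dots> \<le> (\<Sum>z\<in>B. ennreal (K powr q) * ennreal_pow (?L (cube (fst z) (snd z))) q)"
      unfolding sum_distrib_left using BG t by (intro sum_mono cube_bound) auto
    also have "\<dots> = ennreal (K powr q) * (\<Sum>z\<in>B. ennreal_pow (?L (cube (fst z) (snd z))) q)"
      by (simp add: sum_distrib_left)
    \<comment> \<open>The selected cubes are disjoint, so the \<open>q\<close>-th powers of the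
      restricted norms add up to at most that of \<open>f\<close>.\<close>
    also have "\<dots> \<le> ?R"
      using W.sum_lorentz_p1_restrict_le[of "\<lambda>x. \<bar>f x\<bar>" p q B "\<lambda>z. cube (fst z) (snd z)"] B(2) fB p
      by (intro mult_left_mono) (simp_all add: case_prod_unfold)
    finally show ?thesis .
  qed
  have "ennreal t * ennreal_pow (emeasure ?N {x. ennreal t < maximal_fun \<rho> \<theta> \<alpha> f x}) (1 / q)
      \<le> ennreal K * lorentz_p1 p (weight_measure \<mu>) (\<lambda>x. ennreal \<bar>f x\<bar>)" if t: "0 < t" for t
  proof -
    let ?U = "{x. ennreal t < maximal_fun \<rho> \<theta> \<alpha> f x}"
    \<comment> \<open>An increasing exhaustion of the open level set by compact sets; continuity
      from below carries the bound over, whether or not the level set has finite measure.\<close>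
    obtain C where C: "\<And>n. compact (C n)" "\<And>n. C n \<subseteq> ?U" "\<And>n. C n \<subseteq> interior (C (Suc n))" "\<Union> (range C) = ?U"
      by (rule open_Union_compact_subsets[OF open_less_maximal_fun[OF \<rho>, of "ennreal t" \<theta> \<alpha> f]])
        (rule that)
    have "incseq C"
      using C(3) interior_subset by (intro incseq_SucI) blast
    moreover have "range C \<subseteq> sets ?N"
      using C(1) by (auto simp: borel_compact)
    ultimately have "(SUP n. emeasure ?N (C n)) = emeasure ?N ?U"
      using SUP_emeasure_incseq[of C ?N] C(4) by simp
    then have "ennreal (t powr q) * emeasure ?N ?U = (SUP n. ennreal (t powr q) * emeasure ?N (C n))"
      by (simp flip: SUP_mult_left_ennreal)
    also have "\<dots> \<le> ?R"
      using C t by (intro SUP_least compact_bound) auto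
    finally have "ennreal_pow (ennreal (t powr q) * emeasure ?N ?U) (1 / q) \<le> ennreal_pow ?R (1 / q)"
      using q by (intro ennreal_pow_mono) auto
    then show ?thesis
      using t K q by (simp add: ennreal_pow_cmult ennreal_pow_inverse_powr powr_powr)
  qed
  then show ?thesis
    unfolding lorentz_weak_def using q by (auto intro!: SUP_least)
qed

lemma weak_type_of_A_R_norm:
  fixes \<rho> \<mu> \<nu> :: "real^'n \<Rightarrow> real"
  assumes \<theta>: "0 \<le> \<theta>" and \<alpha>: "\<alpha> < real CARD('n)" and \<rho>: "critical_radius \<rho>"
    and \<mu>: "weight \<mu>" and \<nu>: "weight \<nu>" and p: "1 \<le> p" "p \<le> q"
    and fin: "A_R_norm \<rho> \<theta> \<alpha> p q \<mu> \<nu> < \<infinity>"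
  shows "\<exists>C>0. \<forall>f \<in> borel_measurable lebesgue.
    lorentz_weak (ereal q) (weight_measure \<nu>) (maximal_fun \<rho> \<theta> \<alpha> f)
      \<le> ennreal C * lorentz_p1 p (weight_measure \<mu>) (\<lambda>x. ennreal \<bar>f x\<bar>)"
proof -
  define D where "D = (3 ^ CARD('n) * 3 powr \<theta>) powr (1 - \<alpha> / real CARD('n))"
  have D: "0 < D"
    by (simp add: D_def)
  obtain s where s: "A_R_norm \<rho> \<theta> \<alpha> p q \<mu> \<nu> = ennreal s" "0 \<le> s"
    using fin by (cases "A_R_norm \<rho> \<theta> \<alpha> p q \<mu> \<nu>") auto
  \<comment> \<open>Adding 1 keeps the constant positive when the supremum in (3) is 0.\<close>
  define S where "S = s + 1"
  have S: "A_R_norm \<rho> \<theta> \<alpha> p q \<mu> \<nu> \<le> ennreal S" "0 < S"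
    using s by (auto simp: S_def ennreal_leI)
  have bound: "ennreal_pow (emeasure (weight_measure \<nu>) (cube c (3 * r))) (1 / q) * emeasure lebesgue P
        \<le> ennreal (S * D * cube_factor \<rho> \<theta> \<alpha> c r) * ennreal_pow (emeasure (weight_measure \<mu>) P) (1 / p)"
    if r: "0 < r" and P: "P \<in> sets lebesgue" "P \<subseteq> cube c r" for c r P
  proof -
    \<comment> \<open>Condition (3) is used on the tripled cube, which contains all of
      \<open>P\<close>; its factor is at most \<open>D\<close> times that of the original
      cube.\<close>
    have "P \<inter> cube c (3 * r) = P"
      using cube_mono[of r "3 * r" c] r P by auto
    with emeasure_le_of_A_R_norm[OF \<rho> \<mu> p(1) S _ P(1), of "3 * r" c] r
    have "ennreal_pow (emeasure (weight_measure \<nu>) (cube c (3 * r))) (1 / q) * emeasure lebesgue P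
        \<le> ennreal (S * cube_factor \<rho> \<theta> \<alpha> c (3 * r)) * ennreal_pow (emeasure (weight_measure \<mu>) P) (1 / p)"
      by simp
    also have "\<dots> \<le> ennreal (S * D * cube_factor \<rho> \<theta> \<alpha> c r) * ennreal_pow (emeasure (weight_measure \<mu>) P) (1 / p)"
      using cube_factor_3[OF \<rho> r \<theta> \<alpha>, of c] S(2)
      by (intro mult_right_mono ennreal_leI) (auto simp: D_def mult.assoc)
    finally show ?thesis .
  qed
  show ?thesis
  proof (intro exI[of _ "S * D"] conjI ballI)
    show SD: "0 < S * D"
      using D S(2) by simp
    fix f :: "real^'n \<Rightarrow> real" assume "f \<in> borel_measurable lebesgue"
    from weak_type_of_local_bound[OF \<rho> \<mu> \<nu> p SD this bound]
    show "lorentz_weak (ereal q) (weight_measure \<nu>) (maximal_fun \<rho> \<theta> \<alpha> f)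
      \<le> ennreal (S * D) * lorentz_p1 p (weight_measure \<mu>) (\<lambda>x. ennreal \<bar>f x\<bar>)" .
  qed
qed

section \<open>Necessity\<close>

text \<open>For positive heights the distribution function is \<open>emeasure M E\<close> below 1
  and 0 from 1 on, so the integral runs over an interval of length 1.\<close>

lemma lorentz_p1_indicator:
  assumes p: "1 \<le> p" and E: "E \<in> sets M"
  shows "lorentz_p1 p M (\<lambda>x. ennreal \<bar>indicator E x\<bar>) = ennreal p * ennreal_pow (emeasure M E) (1 / p)"
proof -
  have "ennreal_pow (emeasure M {x \<in> space M. y < \<bar>indicator E x :: real\<bar>}) (1 / p) * indicator {0<..} y
      = ennreal_pow (emeasure M E) (1 / p) * indicator {0<..<1} y" for y :: real
  proof -
    consider "y \<le> 0" | "0 < y" "y < 1" | "1 \<le> y"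
      by linarith
    then show ?thesis
    proof cases
      case 2
      then have "{x \<in> space M. y < \<bar>indicator E x :: real\<bar>} = E"
        using sets.sets_into_space[OF E] by (auto simp: indicator_def split: if_splits)
      with 2 show ?thesis by simp
    next
      case 3
      then have *: "{x \<in> space M. y < \<bar>indicator E x :: real\<bar>} = {}"
        by (auto simp: indicator_def)
      show ?thesis
        unfolding * using 3 by simp
    qed simp
  qed
  then show ?thesis
    by (simp add: lorentz_p1_real nn_integral_cmult_indicator del: abs_indicator)
qed

text \<open>A cube is itself admissible in the supremum at each of its points, so the maximal
  function of \<open>indicator P\<close> is at least the normalised average everywhere on it, and
  the cube lies in every lower level set.\<close>

lemma A_R_norm_le_of_restricted_weak_type:
  fixes \<rho> \<mu> \<nu> :: "real^'n \<Rightarrow> real"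
  assumes \<rho>: "critical_radius \<rho>" and \<mu>: "weight \<mu>" and q: "0 < q" and C: "0 < C"
    and weak: "\<And>E. E \<in> sets lebesgue \<Longrightarrow>
      lorentz_weak (ereal q) (weight_measure \<nu>) (maximal_fun \<rho> \<theta> \<alpha> (indicator E))
        \<le> ennreal C * ennreal_pow (emeasure (weight_measure \<mu>) E) (1 / p)"
  shows "A_R_norm \<rho> \<theta> \<alpha> p q \<mu> \<nu> \<le> ennreal (2 * C)"
  unfolding A_R_norm_def SUP_mult_left_ennreal
proof (rule SUP_least, clarify, rule SUP_least, clarify)
  fix c :: "real^'n" and r :: real and P
  assume r: "0 < r" and P: "P \<in> sets lebesgue" "0 < emeasure (weight_measure \<mu>) P"
    "emeasure (weight_measure \<mu>) P < \<infinity>"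
  define F where "F = cube_factor \<rho> \<theta> \<alpha> c r"
  have F: "0 < F"
    unfolding F_def using r by (intro cube_factor_pos[OF \<rho>]) auto
  let ?V = "ennreal_pow (emeasure (weight_measure \<nu>) (cube c r)) (1 / q)"
  let ?X = "ennreal_pow (emeasure (weight_measure \<mu>) P) (1 / p)"
  have "emeasure lebesgue (P \<inter> cube c r) \<le> emeasure lebesgue (cube c r)"
    by (intro emeasure_mono) auto
  also have "\<dots> < top"
    using emeasure_lebesgue_cube_finite by simp
  finally obtain a where a: "emeasure lebesgue (P \<inter> cube c r) = ennreal a" "0 \<le> a"
    by (cases "emeasure lebesgue (P \<inter> cube c r)") auto
  have "ennreal (a / F) * ?V \<le> ennreal (2 * C) * ?X"
  proof (cases "a = 0")
    case False
    with a have a0: "0 < a" by simp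
    \<comment> \<open>Half the normalised average: level sets are defined by strict inequality, so a
      smaller height is needed. This is the source of the 2 in the bound.\<close>
    define y where "y = a / F / 2"
    have y: "0 < y" "y < a / F"
      using a0 F by (auto simp: y_def field_simps)
    have "ennreal y < maximal_fun \<rho> \<theta> \<alpha> (indicator P) x" if x: "x \<in> cube c r" for x
    proof -
      have "(\<integral>\<^sup>+y\<in>cube c r. ennreal \<bar>indicator P y\<bar> \<partial>lebesgue) = (\<integral>\<^sup>+y. indicator (P \<inter> cube c r) y \<partial>lebesgue)"
        by (intro nn_integral_cong) (auto simp: indicator_def)
      also have "\<dots> = ennreal a"
        using P by (simp add: a)
      finally have "(\<integral>\<^sup>+y\<in>cube c r. ennreal \<bar>indicator P y\<bar> \<partial>lebesgue) = ennreal a" .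
      moreover have "ennreal y * ennreal F < ennreal a"
        using y F by (simp add: ennreal_less_iff field_simps flip: ennreal_mult)
      ultimately show ?thesis
        unfolding less_maximal_fun_iff[OF \<rho>] using r x
        by (intro exI[of _ c] exI[of _ r]) (auto simp: F_def)
    qed
    then have "emeasure (weight_measure \<nu>) (cube c r)
        \<le> emeasure (weight_measure \<nu>) {x. ennreal y < maximal_fun \<rho> \<theta> \<alpha> (indicator P) x}"
      using open_less_maximal_fun[OF \<rho>] by (intro emeasure_mono) auto
    then have "ennreal y * ?V
        \<le> ennreal y * ennreal_pow (emeasure (weight_measure \<nu>) {x. ennreal y < maximal_fun \<rho> \<theta> \<alpha> (indicator P) x}) (1 / q)"
      using q by (intro mult_left_mono ennreal_pow_mono) auto
    also have "\<dots> \<le> lorentz_weak (ereal q) (weight_measure \<nu>) (maximal_fun \<rho> \<theta> \<alpha> (indicator P))"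
      using y unfolding lorentz_weak_def by (auto intro!: SUP_upper2[of y])
    also have "\<dots> \<le> ennreal C * ?X"
      by (rule weak[OF P(1)])
    finally have "ennreal 2 * (ennreal y * ?V) \<le> ennreal 2 * (ennreal C * ?X)"
      by (intro mult_left_mono) auto
    moreover have "ennreal 2 * ennreal y = ennreal (a / F)" "ennreal 2 * ennreal C = ennreal (2 * C)"
      using ennreal_mult[of 2 y] ennreal_mult[of 2 C] y C by (simp_all add: y_def)
    ultimately show ?thesis
      by (simp only: mult.assoc[symmetric])
  qed simp
  then have "ennreal (a / F) * ?V * inverse ?X \<le> ennreal (2 * C) * (?X * inverse ?X)"
    unfolding mult.assoc[symmetric] by (intro mult_right_mono) auto
  also have "?X * inverse ?X = 1"
    using P by (intro ennreal_mult_inverse_pow) auto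
  finally show "?V * (emeasure lebesgue (P \<inter> cube c r) / ennreal (cube_factor \<rho> \<theta> \<alpha> c r) * inverse ?X)
      \<le> ennreal (2 * C)"
    using a F by (simp add: divide_ennreal ac_simps flip: F_def)
qed

theorem theorem1p11:
  fixes \<mu> \<nu> \<rho> :: "real^'n \<Rightarrow> real" and \<theta> \<alpha> p q :: real
  assumes "0 \<le> \<theta>" and "0 \<le> \<alpha>" and "\<alpha> < real CARD('n)"
    and "1 \<le> p" and "p \<le> q"
    and "weight \<mu>" and "weight \<nu>" and "critical_radius \<rho>"
  shows
    "((\<exists>C>0. \<forall>f \<in> borel_measurable lebesgue.
          lorentz_weak (ereal q) (weight_measure \<nu>) (maximal_fun \<rho> \<theta> \<alpha> f)
            \<le> ennreal C * lorentz_p1 p (weight_measure \<mu>) (\<lambda>x. ennreal \<bar>f x\<bar>))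
      \<longleftrightarrow>
      (\<exists>C>0. \<forall>E \<in> sets lebesgue.
          lorentz_weak (ereal q) (weight_measure \<nu>) (maximal_fun \<rho> \<theta> \<alpha> (indicator E))
            \<le> ennreal C * ennreal_pow (emeasure (weight_measure \<mu>) E) (1 / p)))
     \<and>
     ((\<exists>C>0. \<forall>E \<in> sets lebesgue.
          lorentz_weak (ereal q) (weight_measure \<nu>) (maximal_fun \<rho> \<theta> \<alpha> (indicator E))
            \<le> ennreal C * ennreal_pow (emeasure (weight_measure \<mu>) E) (1 / p))
      \<longleftrightarrow> A_R_norm \<rho> \<theta> \<alpha> p q \<mu> \<nu> < \<infinity>)
     \<and>
     (A_R_norm \<rho> \<theta> \<alpha> p q \<mu> \<nu> < \<infinity> \<longleftrightarrow> (\<mu>, \<nu>) \<in> A_R_class \<rho> \<theta> \<alpha> p q)"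
    (is "(?strong \<longleftrightarrow> ?restricted) \<and> (_ \<longleftrightarrow> ?norm) \<and> (_ \<longleftrightarrow> ?class)")
proof -
  have q: "0 < q"
    using assms by simp
  have 12: "?restricted" if ?strong
  proof -
    from that obtain C where C: "0 < C" and le: "\<forall>f \<in> borel_measurable lebesgue.
          lorentz_weak (ereal q) (weight_measure \<nu>) (maximal_fun \<rho> \<theta> \<alpha> f)
            \<le> ennreal C * lorentz_p1 p (weight_measure \<mu>) (\<lambda>x. ennreal \<bar>f x\<bar>)"
      by blast
    have "lorentz_weak (ereal q) (weight_measure \<nu>) (maximal_fun \<rho> \<theta> \<alpha> (indicator E))
        \<le> ennreal (C * p) * ennreal_pow (emeasure (weight_measure \<mu>) E) (1 / p)" if E: "E \<in> sets lebesgue" for E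
    proof -
      have "lorentz_weak (ereal q) (weight_measure \<nu>) (maximal_fun \<rho> \<theta> \<alpha> (indicator E))
          \<le> ennreal C * lorentz_p1 p (weight_measure \<mu>) (\<lambda>x. ennreal \<bar>indicator E x\<bar>)"
        by (intro le[rule_format] borel_measurable_indicator E)
      also have "\<dots> = ennreal (C * p) * ennreal_pow (emeasure (weight_measure \<mu>) E) (1 / p)"
        using C E assms(4) by (subst lorentz_p1_indicator) (auto simp: ennreal_mult mult.assoc)
      finally show ?thesis .
    qed
    with C assms(4) show ?restricted
      by (intro exI[of _ "C * p"]) auto
  qed
  have 23: "?norm" if ?restricted
  proof -
    from that obtain C where C: "0 < C" and le: "\<forall>E \<in> sets lebesgue.
        lorentz_weak (ereal q) (weight_measure \<nu>) (maximal_fun \<rho> \<theta> \<alpha> (indicator E))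
          \<le> ennreal C * ennreal_pow (emeasure (weight_measure \<mu>) E) (1 / p)"
      by blast
    have "A_R_norm \<rho> \<theta> \<alpha> p q \<mu> \<nu> \<le> ennreal (2 * C)"
      by (rule A_R_norm_le_of_restricted_weak_type[OF assms(8,6) q C le[rule_format]])
    also have "\<dots> < \<infinity>"
      by simp
    finally show ?norm .
  qed
  have 31: "?strong" if ?norm
    by (rule weak_type_of_A_R_norm[OF assms(1,3,8,6,7,4,5) that])
  have 34: "?class" if ?norm
    using le_less_trans[OF A_R_const_le_A_R_norm[OF assms(8,6,4)] that] by (simp add: A_R_class_def)
  have 43: "?norm" if ?class
  proof -
    have "ennreal p * A_R_const \<rho> \<theta> \<alpha> p q \<mu> \<nu> < \<infinity>"
      using that by (simp add: A_R_class_def ennreal_mult_less_top)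
    with A_R_norm_le_A_R_const[OF assms(8,6,4)] show ?norm
      by (rule le_less_trans)
  qed
  \<comment> \<open>The first three conditions form a cycle and the fourth is tied to the third in
    both directions; the missing implications are compositions.\<close>
  show ?thesis
  proof (intro conjI iffI)
    show ?restricted if ?strong
      by (rule 12[OF that])
    show ?strong if ?restricted
      by (rule 31[OF 23[OF that]])
    show ?norm if ?restricted
      by (rule 23[OF that])
    show ?restricted if ?norm
      by (rule 12[OF 31[OF that]])
    show ?class if ?norm
      by (rule 34[OF that])
    show ?norm if ?class
      by (rule 43[OF that])
  qed
qed

end
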